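(* Let $G$ and $G'$ be finite groups. Then $G$ and $G'$ are both weak almost monomial if and only if $G\times G'$ is weak almost monomial.
   Context: For a finite group $G$, a complex character $\sigma$ of $G$ is monomial if $\sigma=\lambda^G$ for some subgroup $H\le G$ and some linear character $\lambda$ of $H$. $G$ is called weak almost monomial if for any two distinct irreducible complex characters $\chi_i\neq\chi_j$ of $G$ there exists a monomial character $\sigma$ of $G$ with $\langle\chi_i,\sigma\rangle>\langle\chi_j,\sigma\rangle$. *)

theory Defs
  imports
    "HOL-Algebra.Coset"
    "HOL-Library.Complex_Order"
    "Jordan_Normal_Form.VS_Connect"
begin

text \<open>A complex representation of degree \<open>n\<close> is a homomorphism into \<open>GL\<^sub>n(\<complex>)\<close>,
  the unit group of the ring of \<open>n \<times> n\<close> matrices.\<close>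

definition representation :: "('a, 'c) monoid_scheme \<Rightarrow> nat \<Rightarrow> ('a \<Rightarrow> complex mat) \<Rightarrow> bool" where
  "representation G n \<rho> \<longleftrightarrow> \<rho> \<in> hom G (units_of (ring_mat TYPE(complex) n ()))"

definition invariant_subspace ::
  "('a, 'c) monoid_scheme \<Rightarrow> nat \<Rightarrow> ('a \<Rightarrow> complex mat) \<Rightarrow> complex vec set \<Rightarrow> bool" where
  "invariant_subspace G n \<rho> W \<longleftrightarrow>
     VectorSpace.subspace class_ring W (module_vec TYPE(complex) n) \<and>
     (\<forall>g\<in>carrier G. \<forall>w\<in>W. \<rho> g *\<^sub>v w \<in> W)"

definition irreducible_representation ::
  "('a, 'c) monoid_scheme \<Rightarrow> nat \<Rightarrow> ('a \<Rightarrow> complex mat) \<Rightarrow> bool" where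
  "irreducible_representation G n \<rho> \<longleftrightarrow>
     representation G n \<rho> \<and> n > 0 \<and>
     (\<forall>W. invariant_subspace G n \<rho> W \<longrightarrow> W = {0\<^sub>v n} \<or> W = carrier_vec n)"

definition mat_trace :: "complex mat \<Rightarrow> complex" where
  "mat_trace A = (\<Sum>i<dim_row A. A $$ (i, i))"

text \<open>Characters are made extensional (\<open>undefined\<close> off the carrier), so that equality of
  characters in HOL is equality as functions on the group.\<close>

definition afforded_character ::
  "('a, 'c) monoid_scheme \<Rightarrow> ('a \<Rightarrow> complex mat) \<Rightarrow> 'a \<Rightarrow> complex" where
  "afforded_character G \<rho> = (\<lambda>g\<in>carrier G. mat_trace (\<rho> g))"

definition irreducible_characters :: "('a, 'c) monoid_scheme \<Rightarrow> ('a \<Rightarrow> complex) set" where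
  "irreducible_characters G =
     {afforded_character G \<rho> | \<rho> n. irreducible_representation G n \<rho>}"

definition linear_characters :: "('a, 'c) monoid_scheme \<Rightarrow> ('a \<Rightarrow> complex) set" where
  "linear_characters G = {afforded_character G \<rho> | \<rho>. representation G 1 \<rho>}"

definition induced_character ::
  "('a, 'c) monoid_scheme \<Rightarrow> 'a set \<Rightarrow> ('a \<Rightarrow> complex) \<Rightarrow> 'a \<Rightarrow> complex" where
  "induced_character G H \<phi> =
     (\<lambda>g\<in>carrier G. 1 / of_nat (card H) *
        (\<Sum>x | x \<in> carrier G \<and> inv\<^bsub>G\<^esub> x \<otimes>\<^bsub>G\<^esub> g \<otimes>\<^bsub>G\<^esub> x \<in> H.
           \<phi> (inv\<^bsub>G\<^esub> x \<otimes>\<^bsub>G\<^esub> g \<otimes>\<^bsub>G\<^esub> x)))"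

definition monomial_characters :: "('a, 'c) monoid_scheme \<Rightarrow> ('a \<Rightarrow> complex) set" where
  "monomial_characters G =
     {induced_character G H \<phi> | H \<phi>.
        subgroup H G \<and> \<phi> \<in> linear_characters (G\<lparr>carrier := H\<rparr>)}"

definition char_inner ::
  "('a, 'c) monoid_scheme \<Rightarrow> ('a \<Rightarrow> complex) \<Rightarrow> ('a \<Rightarrow> complex) \<Rightarrow> complex" where
  "char_inner G \<chi> \<psi> = 1 / of_nat (Coset.order G) * (\<Sum>g\<in>carrier G. \<chi> g * cnj (\<psi> g))"

text \<open>The inner products below are nonnegative integers; they are compared in the partial order
  on \<open>complex\<close> from \<open>HOL-Library.Complex_Order\<close>, which extends the usual order of the reals.\<close>

definition weak_almost_monomial :: "('a, 'c) monoid_scheme \<Rightarrow> bool" where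
  "weak_almost_monomial G \<longleftrightarrow>
     (\<forall>\<chi>\<in>irreducible_characters G. \<forall>\<psi>\<in>irreducible_characters G. \<chi> \<noteq> \<psi> \<longrightarrow>
        (\<exists>\<sigma>\<in>monomial_characters G. char_inner G \<chi> \<sigma> > char_inner G \<psi> \<sigma>))"

end

theory Submission
  imports Defs "Jordan_Normal_Form.Spectral_Radius" "HOL-Algebra.Multiplicative_Group"
begin

text \<open>
  By Frobenius reciprocity, \<open>\<langle>\<chi>, \<phi>\<^sup>G\<rangle> = \<langle>\<chi>|\<^sub>H, \<phi>\<rangle>\<close>, which is the trace of an idempotent and so a
  natural number.

  If \<open>G\<close> and \<open>G'\<close> are weak almost monomial, write two distinct irreducible characters of the product
  as \<open>\<chi> \<times> \<chi>'\<close> and \<open>\<psi> \<times> \<psi>'\<close>. A product of monomial characters separating the factors separates them;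
  if two factors coincide, the regular character, which is monomial, takes the place of a separating
  one. That irreducible characters of the product factor follows from Schur's lemma alone: averaging
  gives \<open>\<chi>(g, g') \<chi>(1, 1) = \<chi>(g, 1) \<chi>(1, g')\<close>, the restriction of \<open>\<chi>\<close> to each factor is a multiple of
  one irreducible character, and the resulting scalar is \<open>1\<close> because irreducible characters have norm
  \<open>1\<close>.

  Conversely, the property passes to quotients, hence to both factors.
\<close>

section \<open>Matrices over the complex numbers\<close>

text \<open>A strict inequality between products needs more than one separating factor: on the other
  factor the larger side must be positive. A separating \<open>\<sigma>\<close> provides this,
  because \<langle>\<chi>, \<sigma>\<rangle> > \<langle>\<psi>, \<sigma>\<rangle> \<ge> 0; for equal
  factors the regular character does, because its inner product with \<chi> is the degree. This is
  where it matters that the inner products are real and nonnegative.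

  The norm appears as the sum of \<chi>(k) \<chi>(k^-1), equal to the group order. Inverses stand in
  for conjugates because the sum is read off the averages of
  \<open>\<rho> k * A * \<rho> (inv k)\<close>, which Schur's lemma makes scalar. The scalar in the
  factorization is a quotient of degrees, n / (m m'); it enters the norm squared, and positivity of
  degrees leaves only 1.

  The converse goes through quotients because a subgroup of \<open>G \<times>\<times> G'\<close>
  need not be a product of subgroups, so a monomial character of the product need not split into
  monomial characters of the factors.\<close>

lemma mat_trace_mult:
  assumes "A \<in> carrier_mat n m" "B \<in> carrier_mat m n"
  shows "mat_trace (A * B) = (\<Sum>i<n. \<Sum>j<m. A $$ (i, j) * B $$ (j, i))"
  using assms by (auto simp: mat_trace_def scalar_prod_def lessThan_atLeast0 intro!: sum.cong)

lemma mat_trace_comm: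
  assumes "A \<in> carrier_mat n m" "B \<in> carrier_mat m n"
  shows "mat_trace (A * B) = mat_trace (B * A)"
  unfolding mat_trace_mult[OF assms] mat_trace_mult[OF assms(2,1)]
  by (subst sum.swap) (simp add: mult.commute)

lemma mat_trace_one [simp]: "mat_trace (1\<^sub>m n) = of_nat n"
  by (simp add: mat_trace_def)

lemma mat_trace_smult [simp]: "A \<in> carrier_mat n n \<Longrightarrow> mat_trace (c \<cdot>\<^sub>m A) = c * mat_trace A"
  by (auto simp: mat_trace_def sum_distrib_left)

lemma smult_smult_mat:
  fixes a b :: complex
  shows "a \<cdot>\<^sub>m (b \<cdot>\<^sub>m A) = (a * b) \<cdot>\<^sub>m A"
  by (rule eq_matI) (simp_all add: mult.assoc)

lemma eq_mat_by_mult_vec: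
  fixes A B :: "complex mat"
  assumes "A \<in> carrier_mat n m" "B \<in> carrier_mat n m"
    and "\<And>v. v \<in> carrier_vec m \<Longrightarrow> A *\<^sub>v v = B *\<^sub>v v"
  shows "A = B"
proof (rule eq_matI)
  fix i j assume "i < dim_row B" "j < dim_col B"
  with assms(1,2) have ij: "i < n" "j < m" by auto
  have "M $$ (i, j) = (M *\<^sub>v unit_vec m j) $ i" if "M \<in> carrier_mat n m" for M :: "complex mat"
    using that ij scalar_prod_right_unit[OF ij(2)] by auto
  then show "A $$ (i, j) = B $$ (i, j)"
    using assms by (metis unit_vec_carrier)
qed (use assms in auto)

section \<open>Subspaces as ranges of matrices with a left inverse\<close>

lemma subspace_vec_iff:
  "VectorSpace.subspace class_ring W (module_vec TYPE(complex) n) \<longleftrightarrow>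
     W \<subseteq> carrier_vec n \<and> 0\<^sub>v n \<in> W \<and> (\<forall>v\<in>W. \<forall>w\<in>W. v + w \<in> W) \<and> (\<forall>c. \<forall>v\<in>W. c \<cdot>\<^sub>v v \<in> W)"
  using vec_vs vec_module
  by (auto simp: VectorSpace.subspace_def submodule_def module_vec_simps)

text \<open>The vector is the linear combination of the \<open>e j\<close> with coefficients
  \<open>c j\<close>, written entrywise because a matrix-vector product unfolds to this
  form.\<close>

lemma sum_mult_vec_in_subspace:
  fixes e :: "nat \<Rightarrow> complex vec"
  assumes "VectorSpace.subspace class_ring U (module_vec TYPE(complex) m)"
    and "\<And>j. j < u \<Longrightarrow> e j \<in> U"
  shows "vec m (\<lambda>i. \<Sum>j<u. e j $ i * c j) \<in> U"
  using assms(2)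
proof (induction u)
  case 0
  have "vec m (\<lambda>i. 0) = (0\<^sub>v m :: complex vec)" by auto
  then show ?case using assms(1) by (simp add: subspace_vec_iff)
next
  case (Suc u)
  have "e u \<in> carrier_vec m" using Suc.prems assms(1) by (auto simp: subspace_vec_iff)
  then have "vec m (\<lambda>i. \<Sum>j<Suc u. e j $ i * c j) =
      vec m (\<lambda>i. \<Sum>j<u. e j $ i * c j) + c u \<cdot>\<^sub>v e u"
    by auto
  then show ?case using Suc assms(1) by (simp add: subspace_vec_iff)
qed

text \<open>A basis \<open>e\<close> of \<open>U\<close> is grown together with a biorthogonal family \<open>f\<close> of functionals, so that
  no dimension theory is needed: at \<open>m\<close> vectors, the left inverse is also a right inverse.\<close>

lemma subspace_parametrization:
  assumes U: "VectorSpace.subspace class_ring U (module_vec TYPE(complex) m)"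
  obtains u E F where "u \<le> m" "E \<in> carrier_mat m u" "F \<in> carrier_mat u m" "F * E = 1\<^sub>m u"
    "U = (\<lambda>v. E *\<^sub>v v) ` carrier_vec u"
proof -
  define P where "P u e f \<longleftrightarrow> (\<forall>i<u. e i \<in> U) \<and>
    (\<forall>i<u. \<forall>j<u. (\<Sum>s<m. f i s * e j $ s) = (if i = j then 1 else 0))"
    for u :: nat and e :: "nat \<Rightarrow> complex vec" and f :: "nat \<Rightarrow> nat \<Rightarrow> complex"
  \<comment> \<open>Greedy growth: either \<open>k\<close> vectors are reached, or the family stops
    at a length \<open>u\<close> such that no family of length \<open>Suc u\<close> exists at all.
    It is used at \<open>k = m\<close>.\<close>
  have "\<exists>u\<le>k. \<exists>e f. P u e f \<and> (u = k \<or> \<not> (\<exists>e f. P (Suc u) e f))" for k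
  proof (induction k)
    case 0
    then show ?case by (auto simp: P_def)
  next
    case (Suc k)
    then show ?case by (metis le_Suc_eq)
  qed
  then obtain u e f where u: "u \<le> m" and ef: "P u e f"
    and max: "u = m \<or> \<not> (\<exists>e f. P (Suc u) e f)" by metis
  have sub: "U \<subseteq> carrier_vec m" using U by (simp add: subspace_vec_iff)
  define E where "E = mat m u (\<lambda>(i, j). e j $ i)"
  define F where "F = mat u m (\<lambda>(i, j). f i j)"
  have E: "E \<in> carrier_mat m u" and F: "F \<in> carrier_mat u m" by (auto simp: E_def F_def)
  have FE: "F * E = 1\<^sub>m u"
    using ef by (intro eq_matI)
      (auto simp: E_def F_def P_def scalar_prod_def lessThan_atLeast0)
  have EU: "E *\<^sub>v v \<in> U" if "v \<in> carrier_vec u" for v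
  proof -
    have "E *\<^sub>v v = vec m (\<lambda>i. \<Sum>j<u. e j $ i * v $ j)"
      using that by (auto simp: E_def scalar_prod_def lessThan_atLeast0)
    then show ?thesis using sum_mult_vec_in_subspace[OF U] ef by (simp add: P_def)
  qed
  \<comment> \<open>\<open>E * F\<close> projects onto the span of the family. If it moved some
    \<open>x\<close> in \<open>U\<close>, the difference \<open>y\<close> would be a nonzero vector
    of \<open>U\<close> killed by every functional \<open>f i\<close>, and the family could
    grow.\<close>
  have EF: "E *\<^sub>v (F *\<^sub>v x) = x" if x: "x \<in> U" for x
  proof (cases "u = m")
    case True
    then have "E * F = 1\<^sub>m m" using mat_mult_left_right_inverse[of F m E] E F FE by auto
    then show ?thesis using E F x sub assoc_mult_mat_vec[OF E F, of x] by auto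
  next
    case False
    show ?thesis
    proof (rule ccontr)
      assume ne: "E *\<^sub>v (F *\<^sub>v x) \<noteq> x"
      define q where "q = E *\<^sub>v (F *\<^sub>v x)"
      define y where "y = x + (-1) \<cdot>\<^sub>v q"
      have xc: "x \<in> carrier_vec m" using x sub by auto
      have qU: "q \<in> U" unfolding q_def using EU F xc by simp
      have qc: "q \<in> carrier_vec m" using qU sub by auto
      have yU: "y \<in> U" using qU x U by (simp add: y_def subspace_vec_iff)
      have yc: "y \<in> carrier_vec m" using xc qc by (simp add: y_def)
      have y_nth: "y $ s = x $ s - q $ s" if "s < m" for s using that xc qc by (simp add: y_def)
      have "\<exists>t<m. y $ t \<noteq> 0"
      proof (rule ccontr)
        assume "\<not> ?thesis"
        then have "q = x" using y_nth xc qc by (intro eq_vecI) auto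
        then show False using ne q_def by simp
      qed
      then obtain t where t: "t < m" "y $ t \<noteq> 0" by auto
      have Fq: "F *\<^sub>v q = F *\<^sub>v x"
        using assoc_mult_mat_vec[OF F E, of "F *\<^sub>v x"] FE F xc by (simp add: q_def)
      have fy: "(\<Sum>s<m. f i s * y $ s) = 0" if i: "i < u" for i
      proof -
        have "(F *\<^sub>v v) $ i = (\<Sum>s<m. f i s * v $ s)" if "v \<in> carrier_vec m" for v
          using i that by (auto simp: F_def scalar_prod_def lessThan_atLeast0)
        from this[OF qc] this[OF xc] show ?thesis
          using Fq y_nth by (simp add: right_diff_distrib sum_subtractf)
      qed
      \<comment> \<open>The new functional: the coordinate at \<open>t\<close>, corrected so that it
        kills every \<open>e k\<close>, then scaled to take the value 1 at \<open>y\<close>. The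
        correction vanishes at \<open>y\<close> because the \<open>f j\<close> do.\<close>
      define g where "g s = ((if s = t then 1 else 0) - (\<Sum>j<u. f j s * e j $ t)) / y $ t" for s
      have g: "(\<Sum>s<m. g s * v $ s) = (v $ t - (\<Sum>j<u. (\<Sum>s<m. f j s * v $ s) * e j $ t)) / y $ t"
        for v
      proof -
        have "(\<Sum>s<m. g s * v $ s) = (\<Sum>s<m. (if s = t then v $ s else 0)
            - (\<Sum>j<u. f j s * e j $ t * v $ s)) / y $ t"
          unfolding g_def sum_divide_distrib
          by (intro sum.cong) (auto simp: algebra_simps diff_divide_distrib sum_distrib_left)
        also have "\<dots> = (v $ t - (\<Sum>s<m. \<Sum>j<u. f j s * e j $ t * v $ s)) / y $ t"
          using t by (simp add: sum_subtractf)
        also have "(\<Sum>s<m. \<Sum>j<u. f j s * e j $ t * v $ s)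
            = (\<Sum>j<u. (\<Sum>s<m. f j s * v $ s) * e j $ t)"
          by (subst sum.swap) (simp add: sum_distrib_left sum_distrib_right mult_ac)
        finally show ?thesis .
      qed
      have ge: "(\<Sum>s<m. g s * e k $ s) = 0" if "k < u" for k
      proof -
        have "(\<Sum>j<u. (\<Sum>s<m. f j s * e k $ s) * e j $ t) = (\<Sum>j<u. if j = k then e k $ t else 0)"
          using ef that by (intro sum.cong) (auto simp: P_def)
        then show ?thesis using that by (simp add: g)
      qed
      have gy: "(\<Sum>s<m. g s * y $ s) = 1" using fy t by (simp add: g)
      have "P (Suc u) (e(u := y)) (f(u := g))"
        using ef yU fy ge gy unfolding P_def by (auto simp: less_Suc_eq)
      then show False using max False by blast
    qed
  qed
  have "U = (\<lambda>v. E *\<^sub>v v) ` carrier_vec u"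
  proof
    show "U \<subseteq> (\<lambda>v. E *\<^sub>v v) ` carrier_vec u"
    proof
      fix x assume x: "x \<in> U"
      then have "F *\<^sub>v x \<in> carrier_vec u" using F sub by auto
      then show "x \<in> (\<lambda>v. E *\<^sub>v v) ` carrier_vec u" using EF[OF x] by (metis image_eqI)
    qed
  qed (use EU in auto)
  then show thesis using that u E F FE by blast
qed

lemma subspace_range:
  assumes "E \<in> carrier_mat n m"
    and "VectorSpace.subspace class_ring U (module_vec TYPE(complex) m)"
  shows "VectorSpace.subspace class_ring ((\<lambda>v. E *\<^sub>v v) ` U) (module_vec TYPE(complex) n)"
  unfolding subspace_vec_iff
proof (intro conjI ballI allI)
  have U: "U \<subseteq> carrier_vec m" "0\<^sub>v m \<in> U" "\<forall>v\<in>U. \<forall>w\<in>U. v + w \<in> U" "\<forall>c. \<forall>v\<in>U. c \<cdot>\<^sub>v v \<in> U"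
    using assms(2) by (auto simp: subspace_vec_iff)
  show "(\<lambda>v. E *\<^sub>v v) ` U \<subseteq> carrier_vec n" using assms(1) U by auto
  have "E *\<^sub>v 0\<^sub>v m = 0\<^sub>v n" using assms(1) by auto
  then show "0\<^sub>v n \<in> (\<lambda>v. E *\<^sub>v v) ` U" using U(2) by (metis image_eqI)
  fix x y assume xy: "x \<in> (\<lambda>v. E *\<^sub>v v) ` U"
  then obtain v where v: "x = E *\<^sub>v v" "v \<in> U" by auto
  { fix y assume "y \<in> (\<lambda>v. E *\<^sub>v v) ` U"
    then obtain w where "y = E *\<^sub>v w" "w \<in> U" by auto
    then show "x + y \<in> (\<lambda>v. E *\<^sub>v v) ` U"
      using v U mult_add_distrib_mat_vec[OF assms(1), of v w] by (metis image_eqI subsetD) }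
  show "c \<cdot>\<^sub>v x \<in> (\<lambda>v. E *\<^sub>v v) ` U" for c
    using v U mult_mat_vec[OF assms(1), of v c] by (metis image_eqI subsetD)
qed

text \<open>The number is the rank. A parametrization \<open>E\<close> of the range of
  \<open>P\<close> with left inverse \<open>F\<close> gives \<open>P = E * (F * P)\<close> and
  \<open>P * E = E\<close>, so by cyclicity the trace of \<open>P\<close> is that of
  \<open>F * E = 1\<^sub>m u\<close>.\<close>

lemma mat_trace_idempotent:
  assumes P: "P \<in> carrier_mat n n" and "P * P = P"
  shows "\<exists>u::nat. mat_trace P = of_nat u"
proof -
  have "VectorSpace.subspace class_ring (carrier_vec n) (module_vec TYPE(complex) n)"
    by (simp add: subspace_vec_iff)
  from subspace_range[OF P this] obtain u E F where E: "E \<in> carrier_mat n u"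
    and F: "F \<in> carrier_mat u n" and FE: "F * E = 1\<^sub>m u"
    and range: "(\<lambda>v. P *\<^sub>v v) ` carrier_vec n = (\<lambda>v. E *\<^sub>v v) ` carrier_vec u"
    using subspace_parametrization by metis
  have "P * E = E"
  proof (rule eq_mat_by_mult_vec)
    fix v :: "complex vec" assume v: "v \<in> carrier_vec u"
    then obtain w where w: "w \<in> carrier_vec n" "E *\<^sub>v v = P *\<^sub>v w" using range by force
    show "(P * E) *\<^sub>v v = E *\<^sub>v v"
      using v w assoc_mult_mat_vec[OF P E v] assoc_mult_mat_vec[OF P P w(1)] assms(2) by simp
  qed (use P E in auto)
  have "E * (F * P) = P"
  proof (rule eq_mat_by_mult_vec)
    fix w :: "complex vec" assume w: "w \<in> carrier_vec n"
    then obtain v where v: "v \<in> carrier_vec u" "P *\<^sub>v w = E *\<^sub>v v" using range by force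
    have "(E * (F * P)) *\<^sub>v w = E *\<^sub>v (F *\<^sub>v (E *\<^sub>v v))"
      using assoc_mult_mat_vec[OF E mult_carrier_mat[OF F P] w]
        assoc_mult_mat_vec[OF F P w] F P v by simp
    also have "\<dots> = P *\<^sub>v w" using assoc_mult_mat_vec[OF F E v(1)] FE v by simp
    finally show "(E * (F * P)) *\<^sub>v w = P *\<^sub>v w" .
  qed (use P E F in auto)
  then have "mat_trace P = mat_trace (F * P * E)"
    using mat_trace_comm[OF E mult_carrier_mat[OF F P]] by simp
  also have "\<dots> = of_nat u" using \<open>P * E = E\<close> FE E F P by simp
  finally show ?thesis by blast
qed

section \<open>Sums of square matrices\<close>

text \<open>The dimension is an argument because an empty sum must still have a size.\<close>

definition mat_sum :: "nat \<Rightarrow> ('k \<Rightarrow> complex mat) \<Rightarrow> 'k set \<Rightarrow> complex mat" where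
  "mat_sum n f S = mat n n (\<lambda>(i, j). \<Sum>k\<in>S. f k $$ (i, j))"

lemma mat_sum_carrier [simp]: "mat_sum n f S \<in> carrier_mat n n"
  by (simp add: mat_sum_def)

lemma mat_sum_cong:
  "(\<And>k. k \<in> S \<Longrightarrow> f k = g k) \<Longrightarrow> mat_sum n f S = mat_sum n g S"
  by (simp add: mat_sum_def cong: sum.cong)

lemma mat_trace_mat_sum:
  "(\<And>k. k \<in> S \<Longrightarrow> f k \<in> carrier_mat n n) \<Longrightarrow> mat_trace (mat_sum n f S) = (\<Sum>k\<in>S. mat_trace (f k))"
  by (auto simp: mat_trace_def mat_sum_def sum.swap[of _ S] intro!: sum.cong)

lemma mult_mat_sum_left:
  assumes "B \<in> carrier_mat n n" "\<And>k. k \<in> S \<Longrightarrow> f k \<in> carrier_mat n n"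
  shows "B * mat_sum n f S = mat_sum n (\<lambda>k. B * f k) S"
proof (rule eq_matI)
  fix i j assume "i < dim_row (mat_sum n (\<lambda>k. B * f k) S)" "j < dim_col (mat_sum n (\<lambda>k. B * f k) S)"
  then have ij: "i < n" "j < n" by (auto simp: mat_sum_def)
  have "(B * mat_sum n f S) $$ (i, j) = (\<Sum>l<n. B $$ (i, l) * (\<Sum>k\<in>S. f k $$ (l, j)))"
    using ij assms(1) by (simp add: mat_sum_def scalar_prod_def lessThan_atLeast0)
  also have "\<dots> = (\<Sum>k\<in>S. \<Sum>l<n. B $$ (i, l) * f k $$ (l, j))"
    by (subst sum.swap) (simp add: sum_distrib_left)
  also have "\<dots> = mat_sum n (\<lambda>k. B * f k) S $$ (i, j)"
    using ij assms(1) carrier_matD[OF assms(2)]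
    by (auto simp: mat_sum_def scalar_prod_def lessThan_atLeast0 intro!: sum.cong)
  finally show "(B * mat_sum n f S) $$ (i, j) = mat_sum n (\<lambda>k. B * f k) S $$ (i, j)" .
qed (use assms in \<open>auto simp: mat_sum_def\<close>)

lemma mult_mat_sum_right:
  assumes "B \<in> carrier_mat n n" "\<And>k. k \<in> S \<Longrightarrow> f k \<in> carrier_mat n n"
  shows "mat_sum n f S * B = mat_sum n (\<lambda>k. f k * B) S"
proof (rule eq_matI)
  fix i j assume "i < dim_row (mat_sum n (\<lambda>k. f k * B) S)" "j < dim_col (mat_sum n (\<lambda>k. f k * B) S)"
  then have ij: "i < n" "j < n" by (auto simp: mat_sum_def)
  have "(mat_sum n f S * B) $$ (i, j) = (\<Sum>l<n. (\<Sum>k\<in>S. f k $$ (i, l)) * B $$ (l, j))"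
    using ij assms(1) by (simp add: mat_sum_def scalar_prod_def lessThan_atLeast0)
  also have "\<dots> = (\<Sum>k\<in>S. \<Sum>l<n. f k $$ (i, l) * B $$ (l, j))"
    by (subst sum.swap) (simp add: sum_distrib_right)
  also have "\<dots> = mat_sum n (\<lambda>k. f k * B) S $$ (i, j)"
    using ij assms(1) carrier_matD[OF assms(2)]
    by (auto simp: mat_sum_def scalar_prod_def lessThan_atLeast0 intro!: sum.cong)
  finally show "(mat_sum n f S * B) $$ (i, j) = mat_sum n (\<lambda>k. f k * B) S $$ (i, j)" .
qed (use assms in \<open>auto simp: mat_sum_def\<close>)

section \<open>Schur's lemma and averaging\<close>

text \<open>Invertibility of \<open>\<rho> g\<close> is recovered from
  \<open>\<rho> (inv g)\<close>; this is what the clause on \<open>\<rho> \<one>\<close> is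
  for.\<close>

lemma (in group) representation_iff:
  "representation G n \<rho> \<longleftrightarrow> (\<forall>g\<in>carrier G. \<rho> g \<in> carrier_mat n n) \<and> \<rho> \<one> = 1\<^sub>m n \<and>
     (\<forall>g\<in>carrier G. \<forall>h\<in>carrier G. \<rho> (g \<otimes> h) = \<rho> g * \<rho> h)"
proof
  let ?R = "ring_mat TYPE(complex) n ()"
  interpret R: ring ?R by (rule ring_mat)
  assume *: "representation G n \<rho>"
  then have hom: "\<rho> \<in> hom G (units_of ?R)" by (simp add: representation_def)
  then have "\<rho> \<one> = \<one>\<^bsub>units_of ?R\<^esub>" using hom_one R.units_group is_group by blast
  moreover have "\<rho> g \<in> carrier_mat n n" if "g \<in> carrier G" for g
    using hom_in_carrier[OF hom that] by (auto simp: units_of_def Units_def ring_mat_def)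
  ultimately show "(\<forall>g\<in>carrier G. \<rho> g \<in> carrier_mat n n) \<and> \<rho> \<one> = 1\<^sub>m n \<and>
     (\<forall>g\<in>carrier G. \<forall>h\<in>carrier G. \<rho> (g \<otimes> h) = \<rho> g * \<rho> h)"
    using hom by (auto simp: units_of_def ring_mat_def hom_def)
next
  let ?R = "ring_mat TYPE(complex) n ()"
  assume *: "(\<forall>g\<in>carrier G. \<rho> g \<in> carrier_mat n n) \<and> \<rho> \<one> = 1\<^sub>m n \<and>
     (\<forall>g\<in>carrier G. \<forall>h\<in>carrier G. \<rho> (g \<otimes> h) = \<rho> g * \<rho> h)"
  have "\<rho> g \<in> Units ?R" if g: "g \<in> carrier G" for g
  proof -
    have "\<rho> g * \<rho> (inv g) = \<rho> (g \<otimes> inv g)" "\<rho> (inv g) * \<rho> g = \<rho> (inv g \<otimes> g)"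
      using * g inv_closed by metis+
    then show ?thesis using * g unfolding Units_def ring_mat_def by auto
  qed
  then show "representation G n \<rho>"
    using * by (auto simp: representation_def hom_def units_of_def ring_mat_def)
qed

context
  fixes G (structure) and n \<rho>
  assumes G: "group G" and \<rho>: "representation G n \<rho>"
begin

interpretation group G by (rule G)

lemma representation_carrier: "g \<in> carrier G \<Longrightarrow> \<rho> g \<in> carrier_mat n n"
  and representation_one: "\<rho> \<one> = 1\<^sub>m n"
  and representation_mult: "g \<in> carrier G \<Longrightarrow> h \<in> carrier G \<Longrightarrow> \<rho> (g \<otimes> h) = \<rho> g * \<rho> h"
  using \<rho> representation_iff by auto

text \<open>Cyclicity of the trace moves the conjugation from one factor to the other, so that an
  average over conjugates of \<open>B\<close> can be computed as one over conjugates of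
  \<open>A\<close>.\<close>

lemma mat_trace_conj_left:
  assumes g: "g \<in> carrier G" and A: "A \<in> carrier_mat n n" and B: "B \<in> carrier_mat n n"
  shows "mat_trace (\<rho> g * A * \<rho> (inv g) * B) = mat_trace (A * (\<rho> (inv g) * B * \<rho> g))"
proof -
  note c = representation_carrier[OF g] representation_carrier[OF inv_closed[OF g]] A B
  have "\<rho> g * A * \<rho> (inv g) * B = \<rho> g * (A * \<rho> (inv g) * B)"
    using c by (simp add: assoc_mult_mat[of _ n n _ n _ n])
  then have "mat_trace (\<rho> g * A * \<rho> (inv g) * B) = mat_trace ((A * \<rho> (inv g) * B) * \<rho> g)"
    using c mat_trace_comm[of "\<rho> g" n n "A * \<rho> (inv g) * B"] by simp
  then show ?thesis using c by (simp add: assoc_mult_mat[of _ n n _ n _ n])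
qed

lemma mat_trace_conj:
  assumes "g \<in> carrier G" "A \<in> carrier_mat n n"
  shows "mat_trace (\<rho> g * A * \<rho> (inv g)) = mat_trace A"
proof -
  have "\<rho> (inv g) * \<rho> g = 1\<^sub>m n"
    using assms representation_mult[of "inv g" g] representation_one by simp
  then show ?thesis
    using mat_trace_conj_left[of g A "1\<^sub>m n"] assms
      representation_carrier[of g] representation_carrier[of "inv g"] by simp
qed

lemma mat_trace_class_function:
  assumes "g \<in> carrier G" "x \<in> carrier G"
  shows "mat_trace (\<rho> (g \<otimes> x \<otimes> inv g)) = mat_trace (\<rho> x)"
  using mat_trace_conj[of g "\<rho> x"] assms by (simp add: representation_mult representation_carrier)

end

lemma irreducible_representationD:
  assumes "irreducible_representation G n \<rho>"
  shows "representation G n \<rho>" "n > 0"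
    "\<And>W. invariant_subspace G n \<rho> W \<Longrightarrow> W = {0\<^sub>v n} \<or> W = carrier_vec n"
  using assms by (auto simp: irreducible_representation_def)

text \<open>Over the complex numbers and for \<open>n > 0\<close>, \<open>T\<close> has an
  eigenvalue \<open>c\<close>. Its eigenspace \<open>W\<close> is invariant because \<open>T\<close>
  commutes with \<rho>, and it is nonzero, so by irreducibility it is everything.\<close>

lemma schur:
  assumes G: "group G" and irr: "irreducible_representation G n \<rho>" and T: "T \<in> carrier_mat n n"
    and comm: "\<And>g. g \<in> carrier G \<Longrightarrow> \<rho> g * T = T * \<rho> g"
  shows "\<exists>c. T = c \<cdot>\<^sub>m 1\<^sub>m n"
proof -
  note rep = irreducible_representationD[OF irr]
  obtain c v where v: "v \<in> carrier_vec n" "v \<noteq> 0\<^sub>v n" "T *\<^sub>v v = c \<cdot>\<^sub>v v"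
    using spectrum_non_empty[OF T rep(2)] T
    by (auto simp: spectrum_def eigenvalue_def eigenvector_def)
  define W where "W = {v \<in> carrier_vec n. T *\<^sub>v v = c \<cdot>\<^sub>v v}"
  have "invariant_subspace G n \<rho> W"
    unfolding invariant_subspace_def subspace_vec_iff
  proof (intro conjI ballI allI)
    show "0\<^sub>v n \<in> W" using T by (auto simp: W_def)
    show "v + w \<in> W" if "v \<in> W" "w \<in> W" for v w
      using that T by (auto simp: W_def mult_add_distrib_mat_vec[OF T] smult_add_distrib_vec)
    show "a \<cdot>\<^sub>v w \<in> W" if "w \<in> W" for a w
      using that T by (auto simp: W_def mult_mat_vec[OF T] smult_smult_assoc mult.commute)
    show "\<rho> g *\<^sub>v w \<in> W" if g: "g \<in> carrier G" and "w \<in> W" for g w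
    proof -
      have w: "w \<in> carrier_vec n" "T *\<^sub>v w = c \<cdot>\<^sub>v w" using that by (auto simp: W_def)
      have r: "\<rho> g \<in> carrier_mat n n" using representation_carrier[OF G rep(1) g] .
      have "T *\<^sub>v (\<rho> g *\<^sub>v w) = (\<rho> g * T) *\<^sub>v w"
        using assoc_mult_mat_vec[OF T r w(1)] comm[OF g] by simp
      also have "\<dots> = \<rho> g *\<^sub>v (c \<cdot>\<^sub>v w)" using assoc_mult_mat_vec[OF r T w(1)] w by simp
      finally show ?thesis using w r mult_mat_vec[OF r w(1)] by (simp add: W_def)
    qed
  qed (auto simp: W_def)
  then have W: "W = carrier_vec n" using rep(3) v by (auto simp: W_def)
  have "T = c \<cdot>\<^sub>m 1\<^sub>m n"
  proof (rule eq_mat_by_mult_vec)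
    fix w :: "complex vec" assume w: "w \<in> carrier_vec n"
    then have "T *\<^sub>v w = c \<cdot>\<^sub>v w" using W by (auto simp: W_def)
    also have "\<dots> = (c \<cdot>\<^sub>m 1\<^sub>m n) *\<^sub>v w" using w by (auto simp: scalar_prod_smult_left row_smult)
    finally show "T *\<^sub>v w = (c \<cdot>\<^sub>m 1\<^sub>m n) *\<^sub>v w" .
  qed (use T in auto)
  then show ?thesis by blast
qed

lemma (in group) bij_betw_mult_left: "g \<in> carrier G \<Longrightarrow> bij_betw (\<lambda>k. g \<otimes> k) (carrier G) (carrier G)"
  by (rule bij_betw_byWitness[where f' = "\<lambda>k. inv g \<otimes> k"]) (auto simp: m_assoc[symmetric])

lemma (in group) bij_betw_mult_right: "g \<in> carrier G \<Longrightarrow> bij_betw (\<lambda>k. k \<otimes> g) (carrier G) (carrier G)"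
  by (rule bij_betw_byWitness[where f' = "\<lambda>k. k \<otimes> inv g"]) (auto simp: m_assoc)

text \<open>Replacing \<open>k\<close> by \<open>g \<otimes> k\<close> shows that the sum commutes
  with every \<open>\<rho> g\<close>, so Schur's lemma makes it scalar. The scalar is found by
  taking traces, since each summand has the trace of \<open>A\<close>.\<close>

lemma mat_sum_conj_eq:
  fixes G (structure)
  assumes G: "group G" and irr: "irreducible_representation G n \<rho>" and A: "A \<in> carrier_mat n n"
  shows "mat_sum n (\<lambda>k. \<rho> k * A * \<rho> (inv k)) (carrier G) =
    (of_nat (card (carrier G)) * mat_trace A / of_nat n) \<cdot>\<^sub>m 1\<^sub>m n" (is "?T = _")
proof -
  interpret group G by (rule G)
  note rep = irreducible_representationD[OF irr]
  note car = representation_carrier[OF G rep(1)]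
  have conj: "\<rho> k * A * \<rho> (inv k) \<in> carrier_mat n n" if "k \<in> carrier G" for k
    using car A that by (meson inv_closed mult_carrier_mat)
  have "\<rho> g * ?T = ?T * \<rho> g" if g: "g \<in> carrier G" for g
  proof -
    have *: "\<rho> g * (\<rho> k * A * \<rho> (inv k)) = \<rho> (g \<otimes> k) * A * \<rho> (inv (g \<otimes> k)) * \<rho> g"
      if k: "k \<in> carrier G" for k
    proof -
      have "\<rho> (inv k) = \<rho> (inv (g \<otimes> k)) * \<rho> g"
        using g k representation_mult[OF G rep(1), of "inv (g \<otimes> k)" g]
        by (simp add: inv_mult_group m_assoc)
      then show ?thesis
        using g k A car[of g] car[of k] car[of "inv (g \<otimes> k)"] car[of "inv k"]
        by (simp add: representation_mult[OF G rep(1)] assoc_mult_mat[of _ n n _ n _ n])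
    qed
    have "\<rho> g * ?T = mat_sum n (\<lambda>k. \<rho> g * (\<rho> k * A * \<rho> (inv k))) (carrier G)"
      using mult_mat_sum_left[OF car[OF g] conj] .
    also have "\<dots> = mat_sum n (\<lambda>k. \<rho> (g \<otimes> k) * A * \<rho> (inv (g \<otimes> k)) * \<rho> g) (carrier G)"
      using * by (simp add: mat_sum_def cong: sum.cong)
    also have "\<dots> = mat_sum n (\<lambda>k. \<rho> k * A * \<rho> (inv k) * \<rho> g) (carrier G)"
      using sum.reindex_bij_betw[OF bij_betw_mult_left[OF g],
          of "\<lambda>k. (\<rho> k * A * \<rho> (inv k) * \<rho> g) $$ _"]
      by (simp add: mat_sum_def)
    also have "\<dots> = ?T * \<rho> g" by (rule mult_mat_sum_right[OF car[OF g] conj, symmetric])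
    finally show ?thesis .
  qed
  then obtain c where c: "?T = c \<cdot>\<^sub>m 1\<^sub>m n" using schur[OF G irr mat_sum_carrier] by blast
  have "c * of_nat n = mat_trace ?T" by (simp add: c mat_trace_smult[of _ n])
  also have "\<dots> = (\<Sum>k\<in>carrier G. mat_trace (\<rho> k * A * \<rho> (inv k)))"
    using conj by (rule mat_trace_mat_sum)
  also have "\<dots> = of_nat (card (carrier G)) * mat_trace A"
    using mat_trace_conj[OF G rep(1) _ A] by simp
  finally have "c = of_nat (card (carrier G)) * mat_trace A / of_nat n"
    using rep(2) by (simp add: field_simps)
  then show ?thesis using c by simp
qed

text \<open>Averaging the matrix unit \<open>A\<close> at position (i, j) and reading off the entry
  (i, j) gives the sum of \<open>\<rho> k $$ (i, i) * \<rho> (inv k) $$ (j, j)\<close>. It is |G| /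
  n on the diagonal and 0 off it, so the \<open>n\<close> diagonal terms add up to |G|.\<close>

lemma irreducible_character_norm:
  fixes G (structure)
  assumes G: "group G" and irr: "irreducible_representation G n \<rho>"
  shows "(\<Sum>k\<in>carrier G. mat_trace (\<rho> k) * mat_trace (\<rho> (inv k))) = of_nat (card (carrier G))"
proof -
  interpret group G by (rule G)
  note rep = irreducible_representationD[OF irr]
  note car = representation_carrier[OF G rep(1)]
  have entry: "(\<Sum>k\<in>carrier G. \<rho> k $$ (i, i) * \<rho> (inv k) $$ (j, j)) =
      (if i = j then of_nat (card (carrier G)) / of_nat n else 0)" if ij: "i < n" "j < n" for i j
  proof -
    define A :: "complex mat" where "A = mat n n (\<lambda>(a, b). if a = i \<and> b = j then 1 else 0)"
    have A: "A \<in> carrier_mat n n" by (simp add: A_def)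
    have tr: "mat_trace A = (if i = j then 1 else 0)"
    proof -
      have "mat_trace A = (\<Sum>a<n. if a = i then (if i = j then 1 else 0) else 0)"
        by (auto simp: mat_trace_def A_def intro!: sum.cong)
      then show ?thesis using ij by simp
    qed
    have "(\<rho> k * A * \<rho> (inv k)) $$ (i, j) = \<rho> k $$ (i, i) * \<rho> (inv k) $$ (j, j)"
      if k: "k \<in> carrier G" for k
    proof -
      have kc: "\<rho> k \<in> carrier_mat n n" "\<rho> (inv k) \<in> carrier_mat n n" using car k by auto
      have "(\<rho> k * A) $$ (i, b) = (if b = j then \<rho> k $$ (i, i) else 0)" if "b < n" for b
      proof -
        have "(\<rho> k * A) $$ (i, b) = (\<Sum>a<n. \<rho> k $$ (i, a) * A $$ (a, b))"
          using ij that kc A by (auto simp: scalar_prod_def lessThan_atLeast0)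
        also have "\<dots> = (\<Sum>a<n. if a = i then (if b = j then \<rho> k $$ (i, i) else 0) else 0)"
          using that by (intro sum.cong) (auto simp: A_def)
        finally show ?thesis using ij by simp
      qed
      moreover have "(\<rho> k * A * \<rho> (inv k)) $$ (i, j) =
          (\<Sum>b<n. (\<rho> k * A) $$ (i, b) * \<rho> (inv k) $$ (b, j))"
        by (subst index_mult_mat(1)) (use ij kc A in \<open>auto simp: scalar_prod_def lessThan_atLeast0\<close>)
      ultimately have "(\<rho> k * A * \<rho> (inv k)) $$ (i, j) =
          (\<Sum>b<n. if b = j then \<rho> k $$ (i, i) * \<rho> (inv k) $$ (j, j) else 0)"
        by (simp add: if_distrib[of "\<lambda>x. x * _"] cong: if_cong)
      then show ?thesis using ij by simp
    qed
    then have "(\<Sum>k\<in>carrier G. \<rho> k $$ (i, i) * \<rho> (inv k) $$ (j, j)) =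
        mat_sum n (\<lambda>k. \<rho> k * A * \<rho> (inv k)) (carrier G) $$ (i, j)"
      using ij by (simp add: mat_sum_def)
    then show ?thesis using ij tr by (simp add: mat_sum_conj_eq[OF G irr A])
  qed
  have "(\<Sum>k\<in>carrier G. mat_trace (\<rho> k) * mat_trace (\<rho> (inv k))) =
      (\<Sum>k\<in>carrier G. \<Sum>i<n. \<Sum>j<n. \<rho> k $$ (i, i) * \<rho> (inv k) $$ (j, j))"
    using carrier_matD(1)[OF car] by (auto simp: mat_trace_def sum_product intro!: sum.cong)
  also have "\<dots> = (\<Sum>i<n. \<Sum>j<n. \<Sum>k\<in>carrier G. \<rho> k $$ (i, i) * \<rho> (inv k) $$ (j, j))"
    by (subst sum.swap, subst (2) sum.swap) simp
  also have "\<dots> = (\<Sum>i<n. of_nat (card (carrier G)) / of_nat n)"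
    by (intro sum.cong) (simp_all add: entry)
  also have "\<dots> = of_nat (card (carrier G))" using rep(2) by simp
  finally show ?thesis .
qed

text \<open>A nonzero invariant subspace of least dimension \<open>m\<close>, with \<open>E\<close>
  as its basis and \<open>\<omega>\<close> as the action in that basis. A nonzero proper invariant
  subspace of \<open>\<omega>\<close>, pushed forward along \<open>E\<close>, would be a smaller
  one.\<close>

lemma irreducible_constituent:
  assumes G: "group G" and rep: "representation G n \<rho>" and n: "n > 0"
  obtains m \<omega> E F where "irreducible_representation G m \<omega>"
    "E \<in> carrier_mat n m" "F \<in> carrier_mat m n" "F * E = 1\<^sub>m m"
    "\<And>g. g \<in> carrier G \<Longrightarrow> \<rho> g * E = E * \<omega> g"
proof -
  interpret group G by (rule G)
  note car = representation_carrier[OF G rep]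
  \<comment> \<open>\<open>Q m\<close> says that the column space of some \<open>E\<close> with
    \<open>m\<close> columns is invariant. The left inverse \<open>F\<close> encodes independence of
    the columns, and it makes the matrix \<open>M\<close> unique, which later turns the chosen
    \<open>\<omega>\<close> into a homomorphism.\<close>
  define Q where "Q m \<longleftrightarrow> m > 0 \<and> (\<exists>E F. E \<in> carrier_mat n m \<and> F \<in> carrier_mat m n \<and>
    F * E = 1\<^sub>m m \<and> (\<forall>g\<in>carrier G. \<exists>M\<in>carrier_mat m m. \<rho> g * E = E * M))" for m
  define m where "m = (LEAST m. Q m)"
  have "Q n"
    unfolding Q_def
  proof (intro conjI exI[of _ "1\<^sub>m n"] ballI)
    fix g assume g: "g \<in> carrier G"
    then show "\<exists>M\<in>carrier_mat n n. \<rho> g * 1\<^sub>m n = 1\<^sub>m n * M" using car[OF g] by auto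
  qed (use n in auto)
  then have Qm: "Q m" unfolding m_def by (rule LeastI)
  have least: "m \<le> k" if "Q k" for k unfolding m_def using that by (rule Least_le)
  obtain E F where E: "E \<in> carrier_mat n m" and F: "F \<in> carrier_mat m n" and FE: "F * E = 1\<^sub>m m"
    and ex: "\<And>g. g \<in> carrier G \<Longrightarrow> \<exists>M\<in>carrier_mat m m. \<rho> g * E = E * M"
    using Qm unfolding Q_def by blast
  have cancel: "M = N" if "M \<in> carrier_mat m k" "N \<in> carrier_mat m k" "E * M = E * N" for M N k
    using that assoc_mult_mat[OF F E that(1)] assoc_mult_mat[OF F E that(2)] FE
    by (metis left_mult_one_mat)
  define \<omega> where "\<omega> g = (SOME M. M \<in> carrier_mat m m \<and> \<rho> g * E = E * M)" for g
  have \<omega>: "\<omega> g \<in> carrier_mat m m" "\<rho> g * E = E * \<omega> g" if "g \<in> carrier G" for g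
    using someI_ex[of "\<lambda>M. M \<in> carrier_mat m m \<and> \<rho> g * E = E * M"] ex[OF that]
    unfolding \<omega>_def by blast+
  have \<omega>rep: "representation G m \<omega>"
    unfolding representation_iff
  proof (intro conjI ballI)
    show "\<omega> \<one>\<^bsub>G\<^esub> = 1\<^sub>m m"
      using \<omega>[of "\<one>\<^bsub>G\<^esub>"] E representation_one[OF G rep]
      by - (rule cancel[of _ m], auto)
    fix g h assume g: "g \<in> carrier G" and h: "h \<in> carrier G"
    have "E * (\<omega> g * \<omega> h) = \<rho> g * E * \<omega> h"
      using \<omega>[OF g] \<omega>(1)[OF h] E by simp
    also have "\<dots> = \<rho> g * (\<rho> h * E)"
      using \<omega>[OF h] car[OF g] E by simp
    also have "\<dots> = \<rho> (g \<otimes>\<^bsub>G\<^esub> h) * E"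
      using representation_mult[OF G rep g h] car[OF g] car[OF h] E by simp
    also have "\<dots> = E * \<omega> (g \<otimes>\<^bsub>G\<^esub> h)" using \<omega> g h by simp
    finally show "\<omega> (g \<otimes>\<^bsub>G\<^esub> h) = \<omega> g * \<omega> h"
      using \<omega>(1) g h by - (rule cancel[of _ m], auto intro: mult_carrier_mat)
  qed (use \<omega> in auto)
  have "W = {0\<^sub>v m} \<or> W = carrier_vec m" if W: "invariant_subspace G m \<omega> W" for W
  proof (rule disjCI)
    assume ne: "W \<noteq> carrier_vec m"
    have sub: "VectorSpace.subspace class_ring W (module_vec TYPE(complex) m)"
      using W by (simp add: invariant_subspace_def)
    obtain u E' F' where u: "u \<le> m" and E': "E' \<in> carrier_mat m u" and F': "F' \<in> carrier_mat u m"
      and FE': "F' * E' = 1\<^sub>m u" and range: "W = (\<lambda>v. E' *\<^sub>v v) ` carrier_vec u"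
      using subspace_parametrization[OF sub] by metis
    have "u \<noteq> m"
    proof
      assume "u = m"
      then have "E' * F' = 1\<^sub>m m" using mat_mult_left_right_inverse[of F' m E'] E' F' FE' by auto
      then have "x \<in> W" if "x \<in> carrier_vec m" for x
        using assoc_mult_mat_vec[OF E' F' that] that F' range
        by (metis image_eqI mult_mat_vec_carrier one_mult_mat_vec)
      then show False using ne sub by (auto simp: subspace_vec_iff)
    qed
    have "u = 0"
    proof (rule ccontr)
      assume "u \<noteq> 0"
      have inverse: "(F' * F) * (E * E') = 1\<^sub>m u"
      proof -
        have "F' * F * (E * E') = F' * ((F * E) * E')"
          using assoc_mult_mat[OF F' F mult_carrier_mat[OF E E']] assoc_mult_mat[OF F E E'] by simp
        then show ?thesis using FE FE' E' by simp
      qed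
      have "\<exists>M\<in>carrier_mat u u. \<rho> g * (E * E') = (E * E') * M" if g: "g \<in> carrier G" for g
      proof -
        \<comment> \<open>\<open>E' * F'\<close> fixes the range \<open>W\<close> of
          \<open>E'\<close>, and \<open>\<omega> g\<close> maps \<open>W\<close> into
          \<open>W\<close>. Hence \<open>F' * \<omega> g * E'\<close> is the matrix of
          \<open>\<omega> g\<close> on \<open>W\<close>.\<close>
        have inv: "E' * (F' * \<omega> g * E') = \<omega> g * E'"
        proof (rule eq_mat_by_mult_vec)
          fix v :: "complex vec" assume v: "v \<in> carrier_vec u"
          have "E' *\<^sub>v v \<in> W" using v range by auto
          then have "\<omega> g *\<^sub>v (E' *\<^sub>v v) \<in> W" using W g by (auto simp: invariant_subspace_def)
          then obtain w where w: "w \<in> carrier_vec u" "\<omega> g *\<^sub>v (E' *\<^sub>v v) = E' *\<^sub>v w"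
            using range by auto
          have "E' * (F' * \<omega> g * E') *\<^sub>v v = E' *\<^sub>v (F' *\<^sub>v (\<omega> g *\<^sub>v (E' *\<^sub>v v)))"
            using assoc_mult_mat_vec[OF E' mult_carrier_mat[OF mult_carrier_mat[OF F' \<omega>(1)[OF g]] E'] v]
              assoc_mult_mat_vec[OF mult_carrier_mat[OF F' \<omega>(1)[OF g]] E' v]
              assoc_mult_mat_vec[OF F' \<omega>(1)[OF g], of "E' *\<^sub>v v"] E' v by simp
          also have "\<dots> = (\<omega> g * E') *\<^sub>v v"
            using w assoc_mult_mat_vec[OF F' E' w(1)] FE' assoc_mult_mat_vec[OF \<omega>(1)[OF g] E' v]
            by simp
          finally show "E' * (F' * \<omega> g * E') *\<^sub>v v = (\<omega> g * E') *\<^sub>v v" .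
        qed (use E' F' \<omega>(1)[OF g] in auto)
        have M: "F' * \<omega> g * E' \<in> carrier_mat u u"
          using mult_carrier_mat[OF mult_carrier_mat[OF F' \<omega>(1)[OF g]] E'] .
        have "\<rho> g * (E * E') = E * \<omega> g * E'"
          using \<omega>(2)[OF g] assoc_mult_mat[OF car[OF g] E E'] by simp
        also have "\<dots> = E * (E' * (F' * \<omega> g * E'))"
          using inv assoc_mult_mat[OF E \<omega>(1)[OF g] E'] by simp
        also have "\<dots> = (E * E') * (F' * \<omega> g * E')"
          using assoc_mult_mat[OF E E' M] by simp
        finally show ?thesis using M by blast
      qed
      moreover have "E * E' \<in> carrier_mat n u" "F' * F \<in> carrier_mat u n"
        using E F E' F' by auto
      ultimately have "Q u" using inverse \<open>u \<noteq> 0\<close> unfolding Q_def by blast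
      then show False using least u \<open>u \<noteq> m\<close> by fastforce
    qed
    have "E' *\<^sub>v v = 0\<^sub>v m" if "v \<in> carrier_vec u" for v
      using that E' \<open>u = 0\<close> by (auto simp: scalar_prod_def)
    moreover have "0\<^sub>v u \<in> carrier_vec u" by simp
    ultimately show "W = {0\<^sub>v m}" unfolding range by (metis (no_types, lifting) image_cong image_constant)
  qed
  then have "irreducible_representation G m \<omega>"
    using \<omega>rep Qm by (simp add: irreducible_representation_def Q_def)
  then show thesis using that E F FE \<omega>(2) by blast
qed

section \<open>Irreducible representations of a direct product\<close>

text \<open>With the conjugation moved onto \<open>A\<close>, the averaged \<open>A\<close> is a
  scalar matrix. In both applications the summand does not depend on \<open>k\<close>, so the
  average becomes a formula for a single trace.\<close>

lemma irreducible_trace_average: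
  fixes G (structure)
  assumes G: "group G" and irr: "irreducible_representation G n \<rho>"
    and A: "A \<in> carrier_mat n n" and B: "B \<in> carrier_mat n n"
  shows "(\<Sum>k\<in>carrier G. mat_trace (A * (\<rho> (inv k) * B * \<rho> k))) =
    of_nat (card (carrier G)) * mat_trace A * mat_trace B / of_nat n"
proof -
  interpret group G by (rule G)
  note rep = irreducible_representationD[OF irr]
  note car = representation_carrier[OF G rep(1)]
  have conj: "\<rho> k * A * \<rho> (inv k) \<in> carrier_mat n n" if "k \<in> carrier G" for k
    using car A that by (meson inv_closed mult_carrier_mat)
  have "(\<Sum>k\<in>carrier G. mat_trace (A * (\<rho> (inv k) * B * \<rho> k))) =
      (\<Sum>k\<in>carrier G. mat_trace (\<rho> k * A * \<rho> (inv k) * B))"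
    using mat_trace_conj_left[OF G rep(1) _ A B] by simp
  also have "\<dots> = mat_trace (mat_sum n (\<lambda>k. \<rho> k * A * \<rho> (inv k)) (carrier G) * B)"
    using conj B by (subst mult_mat_sum_right[OF B conj])
      (auto intro!: mat_trace_mat_sum[symmetric] mult_carrier_mat[OF conj])
  also have "\<dots> = of_nat (card (carrier G)) * mat_trace A / of_nat n * mat_trace B"
    using B by (simp add: mat_sum_conj_eq[OF G irr A] mult_smult_assoc_mat[of _ n n _ n]
        mat_trace_smult[OF B])
  finally show ?thesis by simp
qed

text \<open>The image of \<open>j\<close> is normal and \<open>G\<close> acts on it through inner automorphisms of \<open>H\<close>. The
  averaged projection onto an \<open>H\<close>-constituent is then scalar, so only that constituent occurs.\<close>

lemma irreducible_restriction_isotypic: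
  fixes G (structure)
  assumes G: "group G" and fin: "finite (carrier G)" and irr: "irreducible_representation G n \<rho>"
    and H: "group H" and j: "j \<in> hom H G"
    and inner: "\<And>k. k \<in> carrier G \<Longrightarrow> \<exists>g\<in>carrier H. \<forall>x\<in>carrier H.
      inv k \<otimes> j x \<otimes> k = j (g \<otimes>\<^bsub>H\<^esub> x \<otimes>\<^bsub>H\<^esub> inv\<^bsub>H\<^esub> g)"
  obtains m \<omega> where "irreducible_representation H m \<omega>"
    "\<And>x. x \<in> carrier H \<Longrightarrow> mat_trace (\<rho> (j x)) = of_nat n / of_nat m * mat_trace (\<omega> x)"
proof -
  interpret group G by (rule G)
  interpret H: group H by (rule H)
  note rep = irreducible_representationD[OF irr]
  note car = representation_carrier[OF G rep(1)]
  have jc: "j x \<in> carrier G" if "x \<in> carrier H" for x using hom_in_carrier[OF j that] .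
  have "j \<one>\<^bsub>H\<^esub> = \<one>" using hom_one[OF j H G] .
  then have repj: "representation H n (\<lambda>x. \<rho> (j x))"
    using jc hom_mult[OF j] car representation_one[OF G rep(1)] representation_mult[OF G rep(1)]
    by (auto simp: H.representation_iff)
  obtain m \<omega> E F where \<omega>: "irreducible_representation H m \<omega>"
    and E: "E \<in> carrier_mat n m" and F: "F \<in> carrier_mat m n" and FE: "F * E = 1\<^sub>m m"
    and intertwine: "\<And>x. x \<in> carrier H \<Longrightarrow> \<rho> (j x) * E = E * \<omega> x"
    using irreducible_constituent[OF H repj rep(2)] by metis
  note \<omega>rep = irreducible_representationD[OF \<omega>]
  \<comment> \<open>\<open>E * F\<close> projects onto the constituent. It is the matrix
    \<open>A\<close> of the trace average, with trace \<open>m\<close>, and against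
    \<open>\<rho> (j x)\<close> it detects \<open>\<omega>\<close> alone.\<close>
  have EF: "E * F \<in> carrier_mat n n" using E F by auto
  have trEF: "mat_trace (E * F) = of_nat m" using mat_trace_comm[OF E F] FE by simp
  have tr: "mat_trace (E * F * \<rho> (j x)) = mat_trace (\<omega> x)" if x: "x \<in> carrier H" for x
  proof -
    have r: "\<rho> (j x) \<in> carrier_mat n n" using car jc x by blast
    have w: "\<omega> x \<in> carrier_mat m m" using representation_carrier[OF H \<omega>rep(1) x] .
    have "mat_trace (E * F * \<rho> (j x)) = mat_trace (F * \<rho> (j x) * E)"
      using mat_trace_comm[OF E mult_carrier_mat[OF F r]] assoc_mult_mat[OF E F r] by simp
    also have "F * \<rho> (j x) * E = F * E * \<omega> x"
      using assoc_mult_mat[OF F r E] assoc_mult_mat[OF F E w] intertwine[OF x] by simp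
    finally show ?thesis using FE w by simp
  qed
  have "mat_trace (\<rho> (j x)) = of_nat n / of_nat m * mat_trace (\<omega> x)" if x: "x \<in> carrier H" for x
  proof -
    \<comment> \<open>Conjugating \<open>j x\<close> by \<open>k\<close> only replaces
      \<open>x\<close> by an \<open>H\<close>-conjugate, and the trace of \<open>\<omega>\<close> is
      a class function: the summand is constant in \<open>k\<close>.\<close>
    have "mat_trace (E * F * (\<rho> (inv k) * \<rho> (j x) * \<rho> k)) = mat_trace (\<omega> x)"
      if k: "k \<in> carrier G" for k
    proof -
      obtain g where g: "g \<in> carrier H" "inv k \<otimes> j x \<otimes> k = j (g \<otimes>\<^bsub>H\<^esub> x \<otimes>\<^bsub>H\<^esub> inv\<^bsub>H\<^esub> g)"
        using inner[OF k] x by blast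
      have "\<rho> (inv k) * \<rho> (j x) * \<rho> k = \<rho> (j (g \<otimes>\<^bsub>H\<^esub> x \<otimes>\<^bsub>H\<^esub> inv\<^bsub>H\<^esub> g))"
        using k jc[OF x] by (simp add: representation_mult[OF G rep(1), symmetric] g(2))
      then show ?thesis using g(1) x tr mat_trace_class_function[OF H \<omega>rep(1) g(1) x] by simp
    qed
    then have "of_nat (card (carrier G)) * mat_trace (\<omega> x) =
        of_nat (card (carrier G)) * of_nat m * mat_trace (\<rho> (j x)) / of_nat n"
      using irreducible_trace_average[OF G irr EF car[OF jc[OF x]]] trEF by simp
    moreover have "card (carrier G) \<noteq> 0" using fin one_closed by auto
    ultimately show ?thesis using rep(2) \<omega>rep(2) by (simp add: field_simps)
  qed
  then show thesis using that \<omega> by blast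
qed

lemma irreducible_representation_DirProd:
  assumes G: "group G" "finite (carrier G)" and H: "group H" "finite (carrier H)"
    and irr: "irreducible_representation (G \<times>\<times> H) n \<rho>"
  obtains m \<omega> m' \<omega>' where "irreducible_representation G m \<omega>" "irreducible_representation H m' \<omega>'"
    "\<And>g h. g \<in> carrier G \<Longrightarrow> h \<in> carrier H \<Longrightarrow>
      mat_trace (\<rho> (g, h)) = mat_trace (\<omega> g) * mat_trace (\<omega>' h)"
proof -
  interpret G: group G by (rule G(1))
  interpret H: group H by (rule H(1))
  let ?K = "G \<times>\<times> H"
  have K: "group ?K" using DirProd_group G(1) H(1) .
  interpret K: group ?K by (rule K)
  have finK: "finite (carrier ?K)" using G H by simp
  note rep = irreducible_representationD[OF irr]
  note car = representation_carrier[OF K rep(1)]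
  have "(\<lambda>g. (g, \<one>\<^bsub>H\<^esub>)) \<in> hom G ?K" "(\<lambda>h. (\<one>\<^bsub>G\<^esub>, h)) \<in> hom H ?K" by (auto simp: hom_def)
  note emb = this
  obtain m \<omega> where \<omega>: "irreducible_representation G m \<omega>"
    "\<And>g. g \<in> carrier G \<Longrightarrow> mat_trace (\<rho> (g, \<one>\<^bsub>H\<^esub>)) = of_nat n / of_nat m * mat_trace (\<omega> g)"
  proof (rule irreducible_restriction_isotypic[OF K finK irr G(1) emb(1)])
    fix k assume "k \<in> carrier ?K"
    then obtain a b where k: "k = (a, b)" "a \<in> carrier G" "b \<in> carrier H" by auto
    then show "\<exists>g\<in>carrier G. \<forall>x\<in>carrier G. inv\<^bsub>?K\<^esub> k \<otimes>\<^bsub>?K\<^esub> (x, \<one>\<^bsub>H\<^esub>) \<otimes>\<^bsub>?K\<^esub> k =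
        (g \<otimes>\<^bsub>G\<^esub> x \<otimes>\<^bsub>G\<^esub> inv\<^bsub>G\<^esub> g, \<one>\<^bsub>H\<^esub>)"
      \<comment> \<open>For k = (a, b), conjugating (x, 1) by the inverse of k only sees
        \<open>a\<close>; the second coordinate cancels.\<close>
      by (intro bexI[of _ "inv\<^bsub>G\<^esub> a"]) (auto simp: G(1) H(1))
  qed blast
  obtain m' \<omega>' where \<omega>': "irreducible_representation H m' \<omega>'"
    "\<And>h. h \<in> carrier H \<Longrightarrow> mat_trace (\<rho> (\<one>\<^bsub>G\<^esub>, h)) = of_nat n / of_nat m' * mat_trace (\<omega>' h)"
  proof (rule irreducible_restriction_isotypic[OF K finK irr H(1) emb(2)])
    fix k assume "k \<in> carrier ?K"
    then obtain a b where k: "k = (a, b)" "a \<in> carrier G" "b \<in> carrier H" by auto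
    then show "\<exists>g\<in>carrier H. \<forall>x\<in>carrier H. inv\<^bsub>?K\<^esub> k \<otimes>\<^bsub>?K\<^esub> (\<one>\<^bsub>G\<^esub>, x) \<otimes>\<^bsub>?K\<^esub> k =
        (\<one>\<^bsub>G\<^esub>, g \<otimes>\<^bsub>H\<^esub> x \<otimes>\<^bsub>H\<^esub> inv\<^bsub>H\<^esub> g)"
      by (intro bexI[of _ "inv\<^bsub>H\<^esub> b"]) (auto simp: G(1) H(1))
  qed blast
  note pos = irreducible_representationD(2)[OF \<omega>(1)] irreducible_representationD(2)[OF \<omega>'(1)] rep(2)
  have cardK: "card (carrier G \<times> carrier H) = card (carrier G) * card (carrier H)"
    by (simp add: card_cartesian_product)
  have card0: "card (carrier G) \<noteq> 0" "card (carrier H) \<noteq> 0"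
    using G(2) H(2) G.one_closed H.one_closed by auto
  have factor: "mat_trace (\<rho> (g, h)) =
      of_nat n / (of_nat m * of_nat m') * (mat_trace (\<omega> g) * mat_trace (\<omega>' h))"
    if g: "g \<in> carrier G" and h: "h \<in> carrier H" for g h
  proof -
    let ?A = "\<rho> (g, \<one>\<^bsub>H\<^esub>)" and ?B = "\<rho> (\<one>\<^bsub>G\<^esub>, h)"
    have ghK: "(g, \<one>\<^bsub>H\<^esub>) \<in> carrier ?K" "(\<one>\<^bsub>G\<^esub>, h) \<in> carrier ?K" using g h by auto
    have AB: "?A \<in> carrier_mat n n" "?B \<in> carrier_mat n n" using car g h by auto
    have "mat_trace (?A * (\<rho> (inv\<^bsub>?K\<^esub> k) * ?B * \<rho> k)) = mat_trace (\<rho> (g, h))"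
      if kK: "k \<in> carrier ?K" for k
    proof -
      obtain a b where k: "k = (a, b)" "a \<in> carrier G" "b \<in> carrier H" using kK by auto
      \<comment> \<open>The conjugate of (1, h) is (1, b^-1 h b). Since (g, 1) commutes with
        \<open>?b\<close>, the product (g, b^-1 h b) is the conjugate of (g, h) by \<open>?b\<close>
        and has the same trace under \<rho>.\<close>
      let ?b = "(\<one>\<^bsub>G\<^esub>, inv\<^bsub>H\<^esub> b)"
      have "?A * (\<rho> (inv\<^bsub>?K\<^esub> k) * ?B * \<rho> k) =
          \<rho> ((g, \<one>\<^bsub>H\<^esub>) \<otimes>\<^bsub>?K\<^esub> (inv\<^bsub>?K\<^esub> k \<otimes>\<^bsub>?K\<^esub> (\<one>\<^bsub>G\<^esub>, h) \<otimes>\<^bsub>?K\<^esub> k))"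
        using kK ghK
        by (simp add: representation_mult[OF K rep(1)] del: carrier_DirProd mult_DirProd inv_DirProd)
      also have "(g, \<one>\<^bsub>H\<^esub>) \<otimes>\<^bsub>?K\<^esub> (inv\<^bsub>?K\<^esub> k \<otimes>\<^bsub>?K\<^esub> (\<one>\<^bsub>G\<^esub>, h) \<otimes>\<^bsub>?K\<^esub> k) =
          ?b \<otimes>\<^bsub>?K\<^esub> (g, h) \<otimes>\<^bsub>?K\<^esub> inv\<^bsub>?K\<^esub> ?b"
        using k g h by (simp add: G(1) H(1))
      finally show ?thesis
        using mat_trace_class_function[OF K rep(1), of ?b "(g, h)"] k g h by simp
    qed
    then have "of_nat (card (carrier ?K)) * mat_trace (\<rho> (g, h)) =
        of_nat (card (carrier ?K)) * mat_trace ?A * mat_trace ?B / of_nat n"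
      using irreducible_trace_average[OF K irr AB] by simp
    then show ?thesis using cardK card0 pos \<omega>(2)[OF g] \<omega>'(2)[OF h] by (simp add: field_simps)
  qed
  \<comment> \<open>The norm sum of \<rho> is \<open>c\<^sup>2\<close> times the product of the norm
    sums of \<open>\<omega>\<close> and \<open>\<omega>'\<close>. Both sides are the order of the
    product group, so \<open>c\<^sup>2 = 1\<close>; passing to natural numbers excludes c =
    -1.\<close>
  define c :: complex where "c = of_nat n / (of_nat m * of_nat m')"
  have "of_nat (card (carrier ?K)) =
      (\<Sum>(g, h)\<in>carrier G \<times> carrier H. mat_trace (\<rho> (g, h)) * mat_trace (\<rho> (inv\<^bsub>G\<^esub> g, inv\<^bsub>H\<^esub> h)))"
    by (subst irreducible_character_norm[OF K irr, symmetric])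
      (auto simp: G(1) H(1) intro!: sum.cong)
  also have "\<dots> = (\<Sum>(g, h)\<in>carrier G \<times> carrier H. c\<^sup>2 *
      ((mat_trace (\<omega> g) * mat_trace (\<omega> (inv\<^bsub>G\<^esub> g))) * (mat_trace (\<omega>' h) * mat_trace (\<omega>' (inv\<^bsub>H\<^esub> h)))))"
    by (intro sum.cong) (auto simp: factor c_def[symmetric] power2_eq_square)
  also have "\<dots> = c\<^sup>2 * ((\<Sum>g\<in>carrier G. mat_trace (\<omega> g) * mat_trace (\<omega> (inv\<^bsub>G\<^esub> g))) *
      (\<Sum>h\<in>carrier H. mat_trace (\<omega>' h) * mat_trace (\<omega>' (inv\<^bsub>H\<^esub> h))))"
    by (subst sum_product) (simp add: sum_distrib_left sum.cartesian_product case_prod_unfold)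
  also have "\<dots> = c\<^sup>2 * of_nat (card (carrier ?K))"
    using irreducible_character_norm[OF G(1) \<omega>(1)] irreducible_character_norm[OF H(1) \<omega>'(1)]
    by (simp add: cardK)
  finally have "c\<^sup>2 = 1" using cardK card0 by simp
  then have "(of_nat n :: complex)\<^sup>2 = (of_nat (m * m'))\<^sup>2"
    using pos by (simp add: c_def field_simps power_mult_distrib)
  then have "n\<^sup>2 = (m * m')\<^sup>2" by (metis of_nat_eq_iff of_nat_power)
  then have "n = m * m'" by (simp add: power2_eq_iff_nonneg)
  then have "mat_trace (\<rho> (g, h)) = mat_trace (\<omega> g) * mat_trace (\<omega>' h)"
    if "g \<in> carrier G" "h \<in> carrier H" for g h
    using factor[OF that] pos by simp
  then show thesis using that \<omega>(1) \<omega>'(1) by blast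
qed

section \<open>Linear and monomial characters\<close>

lemma linear_characters_iff:
  fixes G (structure)
  assumes G: "group G"
  shows "\<phi> \<in> linear_characters G \<longleftrightarrow> \<phi> \<in> extensional (carrier G) \<and> \<phi> \<one> = 1 \<and>
    (\<forall>g\<in>carrier G. \<forall>h\<in>carrier G. \<phi> (g \<otimes> h) = \<phi> g * \<phi> h)" (is "_ \<longleftrightarrow> ?R")
proof
  interpret group G by (rule G)
  { assume "\<phi> \<in> linear_characters G"
    then obtain \<rho> where \<rho>: "representation G 1 \<rho>" and \<phi>: "\<phi> = afforded_character G \<rho>"
      by (auto simp: linear_characters_def)
    have "\<phi> g = \<rho> g $$ (0, 0)" if "g \<in> carrier G" for g
      using representation_carrier[OF G \<rho> that] that
      by (auto simp: \<phi> afforded_character_def mat_trace_def)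
    moreover have "(\<rho> g * \<rho> h) $$ (0, 0) = \<rho> g $$ (0, 0) * \<rho> h $$ (0, 0)"
      if "g \<in> carrier G" "h \<in> carrier G" for g h
      using representation_carrier[OF G \<rho> that(1)] representation_carrier[OF G \<rho> that(2)]
      by (auto simp: scalar_prod_def)
    moreover have "\<phi> \<in> extensional (carrier G)" by (simp add: \<phi> afforded_character_def)
    ultimately show ?R
      using representation_one[OF G \<rho>] representation_mult[OF G \<rho>] by simp }
  { assume R: ?R
    define \<rho> where "\<rho> g = mat 1 1 (\<lambda>_. \<phi> g)" for g
    have "representation G 1 \<rho>"
      using R by (auto simp: representation_iff \<rho>_def scalar_prod_def intro!: eq_matI)
    moreover have "\<phi> = afforded_character G \<rho>"
      using R by (intro extensionalityI[of _ "carrier G"])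
        (auto simp: afforded_character_def \<rho>_def mat_trace_def)
    ultimately show "\<phi> \<in> linear_characters G" by (auto simp: linear_characters_def) }
qed

text \<open>Values are roots of unity, since \<open>g\<close> raised to the group order is \<one>.
  Thus \<open>cnj (\<phi> g)\<close> is the inverse of \<open>\<phi> g\<close>.\<close>

lemma linear_character_norm:
  fixes G (structure)
  assumes G: "group G" and fin: "finite (carrier G)" and \<phi>: "\<phi> \<in> linear_characters G"
    and g: "g \<in> carrier G"
  shows "\<phi> g * cnj (\<phi> g) = 1"
proof -
  interpret group G by (rule G)
  have "\<phi> (g [^] k) = \<phi> g ^ k" for k :: nat
    using \<phi> g by (induction k) (simp_all add: linear_characters_iff[OF G])
  then have "\<phi> g ^ Coset.order G = 1"
    using pow_order_eq_1[OF g] \<phi> by (metis linear_characters_iff[OF G])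
  then have "cmod (\<phi> g) ^ Coset.order G = 1" by (metis norm_one norm_power)
  moreover have "Coset.order G > 0" using fin by (simp add: order_gt_0_iff_finite)
  ultimately have "cmod (\<phi> g) = 1"
    by (metis norm_ge_zero power_eq_1_iff less_numeral_extra(3) real_norm_def abs_of_nonneg)
  then show ?thesis by (simp add: complex_norm_square[symmetric])
qed

section \<open>Inner products with monomial characters\<close>

text \<open>Frobenius reciprocity for a class function \<open>\<chi>\<close>. Swapping the sums over
  \<open>g\<close> and \<open>x\<close> and substituting g = x y x^-1 turns each of the |G| inner
  sums into the same sum over \<open>H\<close>.\<close>

lemma char_inner_induced_character:
  fixes G (structure)
  assumes G: "group G" and fin: "finite (carrier G)" and H: "subgroup H G"
    and conj: "\<And>g x. g \<in> carrier G \<Longrightarrow> x \<in> carrier G \<Longrightarrow> \<chi> (g \<otimes> x \<otimes> inv g) = \<chi> x"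
  shows "char_inner G \<chi> (induced_character G H \<phi>) = char_inner (G\<lparr>carrier := H\<rparr>) \<chi> \<phi>"
proof -
  interpret group G by (rule G)
  have HG: "H \<subseteq> carrier G" using subgroup.subset[OF H] .
  have finH: "finite H" using HG fin finite_subset by blast
  let ?f = "\<lambda>x g. if inv x \<otimes> g \<otimes> x \<in> H then \<chi> g * cnj (\<phi> (inv x \<otimes> g \<otimes> x)) else 0"
  have "(\<Sum>g\<in>carrier G. ?f x g) = (\<Sum>h\<in>H. \<chi> h * cnj (\<phi> h))" if x: "x \<in> carrier G" for x
  proof -
    have "bij_betw (\<lambda>y. x \<otimes> y \<otimes> inv x) (carrier G) (carrier G)"
      using bij_betw_trans[OF bij_betw_mult_left[OF x] bij_betw_mult_right[OF inv_closed[OF x]]]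
      by (simp add: o_def)
    then have "(\<Sum>g\<in>carrier G. ?f x g) = (\<Sum>y\<in>carrier G. ?f x (x \<otimes> y \<otimes> inv x))"
      by (rule sum.reindex_bij_betw[symmetric])
    also have "\<dots> = (\<Sum>y\<in>carrier G. if y \<in> H then \<chi> y * cnj (\<phi> y) else 0)"
    proof (intro sum.cong refl)
      fix y assume y: "y \<in> carrier G"
      have "inv x \<otimes> (x \<otimes> y \<otimes> inv x) \<otimes> x = y" using x y by (simp add: m_assoc inv_solve_left')
      then show "?f x (x \<otimes> y \<otimes> inv x) = (if y \<in> H then \<chi> y * cnj (\<phi> y) else 0)"
        using conj[OF x y] by simp
    qed
    also have "\<dots> = (\<Sum>h\<in>H. \<chi> h * cnj (\<phi> h))"
      using HG fin by (simp add: sum.inter_restrict[symmetric] Int_absorb1)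
    finally show ?thesis .
  qed
  then have avg: "(\<Sum>x\<in>carrier G. \<Sum>g\<in>carrier G. ?f x g) = of_nat (Coset.order G) * (\<Sum>h\<in>H. \<chi> h * cnj (\<phi> h))"
    by (simp add: Coset.order_def)
  have "\<chi> g * cnj (induced_character G H \<phi> g) = 1 / of_nat (card H) * (\<Sum>x\<in>carrier G. ?f x g)"
    if "g \<in> carrier G" for g
    using that fin
    by (simp add: induced_character_def sum_distrib_left sum.inter_filter[symmetric] cnj_sum mult_ac)
  then have "(\<Sum>g\<in>carrier G. \<chi> g * cnj (induced_character G H \<phi> g)) =
      1 / of_nat (card H) * (\<Sum>x\<in>carrier G. \<Sum>g\<in>carrier G. ?f x g)"
    by (subst sum.swap) (simp add: sum_distrib_left)
  also note avg
  finally show ?thesis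
    using fin one_closed by (auto simp: char_inner_def Coset.order_def)
qed

text \<open>The idempotent is \<open>P\<close>, the average of \<open>cnj (\<phi> g)\<close> times
  \<open>\<rho> g\<close>, which projects onto the vectors on which the group acts through \<phi>.
  Reindexing gives \<open>\<rho> g * P = \<phi> g \<cdot>\<^sub>m P\<close>, hence
  \<open>P * P = P\<close>; its trace is the inner product.\<close>

lemma char_inner_linear_character_nat:
  fixes G (structure)
  assumes G: "group G" and fin: "finite (carrier G)" and rep: "representation G n \<rho>"
    and \<phi>: "\<phi> \<in> linear_characters G"
  shows "\<exists>u::nat. char_inner G (\<lambda>g. mat_trace (\<rho> g)) \<phi> = of_nat u"
proof -
  interpret group G by (rule G)
  note car = representation_carrier[OF G rep]
  define c :: complex where "c = 1 / of_nat (card (carrier G))"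
  define f where "f g = (c * cnj (\<phi> g)) \<cdot>\<^sub>m \<rho> g" for g
  define P where "P = mat_sum n f (carrier G)"
  have fc: "f g \<in> carrier_mat n n" if "g \<in> carrier G" for g using car[OF that] by (simp add: f_def)
  have P: "P \<in> carrier_mat n n" by (simp add: P_def)
  have \<rho>P: "\<rho> g * P = \<phi> g \<cdot>\<^sub>m P" if g: "g \<in> carrier G" for g
  proof -
    have "\<rho> g * f h = \<phi> g \<cdot>\<^sub>m f (g \<otimes> h)" if h: "h \<in> carrier G" for h
    proof -
      have "\<phi> g * cnj (\<phi> (g \<otimes> h)) = (\<phi> g * cnj (\<phi> g)) * cnj (\<phi> h)"
        using \<phi> g h by (simp add: linear_characters_iff[OF G])
      then have "\<phi> g * cnj (\<phi> (g \<otimes> h)) = cnj (\<phi> h)"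
        using linear_character_norm[OF G fin \<phi> g] by simp
      then show ?thesis
        using mult_smult_distrib[OF car[OF g] car[OF h], of "c * cnj (\<phi> h)"]
        by (simp add: f_def representation_mult[OF G rep g h] smult_smult_mat mult_ac)
    qed
    then have "mat_sum n (\<lambda>h. \<rho> g * f h) (carrier G) =
        mat_sum n (\<lambda>h. \<phi> g \<cdot>\<^sub>m f (g \<otimes> h)) (carrier G)"
      by (rule mat_sum_cong)
    then have "\<rho> g * P = mat_sum n (\<lambda>h. \<phi> g \<cdot>\<^sub>m f (g \<otimes> h)) (carrier G)"
      using mult_mat_sum_left[OF car[OF g] fc, of "carrier G"] by (simp add: P_def)
    also have "\<dots> = mat_sum n (\<lambda>h. \<phi> g \<cdot>\<^sub>m f h) (carrier G)"
      using sum.reindex_bij_betw[OF bij_betw_mult_left[OF g], of "\<lambda>h. (\<phi> g \<cdot>\<^sub>m f h) $$ _"]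
      by (simp add: mat_sum_def)
    also have "\<dots> = \<phi> g \<cdot>\<^sub>m P"
      using carrier_matD[OF fc] by (auto simp: P_def mat_sum_def sum_distrib_left intro!: eq_matI)
    finally show ?thesis .
  qed
  have "f g * P = c \<cdot>\<^sub>m P" if g: "g \<in> carrier G" for g
  proof -
    have "f g * P = (c * cnj (\<phi> g)) \<cdot>\<^sub>m (\<phi> g \<cdot>\<^sub>m P)"
      using mult_smult_assoc_mat[OF car[OF g] P] \<rho>P[OF g] by (simp add: f_def)
    then show ?thesis
      using linear_character_norm[OF G fin \<phi> g] by (simp add: smult_smult_mat mult_ac)
  qed
  then have "mat_sum n (\<lambda>g. f g * P) (carrier G) = mat_sum n (\<lambda>g. c \<cdot>\<^sub>m P) (carrier G)"
    by (rule mat_sum_cong)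
  then have "P * P = mat_sum n (\<lambda>g. c \<cdot>\<^sub>m P) (carrier G)"
    using mult_mat_sum_right[OF P fc, of "carrier G"] by (simp add: P_def)
  also have "\<dots> = P"
  proof -
    have "card (carrier G) \<noteq> 0" using fin one_closed by auto
    then show ?thesis using P by (auto simp: mat_sum_def c_def intro!: eq_matI)
  qed
  finally obtain u :: nat where "mat_trace P = of_nat u" using mat_trace_idempotent[OF P] by blast
  moreover have "mat_trace P = (\<Sum>g\<in>carrier G. c * cnj (\<phi> g) * mat_trace (\<rho> g))"
    using mat_trace_mat_sum[of "carrier G" f n, OF fc] car
    by (simp add: P_def f_def mat_trace_smult[of _ n])
  then have "mat_trace P = char_inner G (\<lambda>g. mat_trace (\<rho> g)) \<phi>"
    by (simp add: char_inner_def Coset.order_def c_def sum_distrib_left mult_ac)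
  ultimately show ?thesis by metis
qed

lemma char_inner_cong:
  assumes "\<And>g. g \<in> carrier G \<Longrightarrow> \<chi> g = \<chi>' g" "\<And>g. g \<in> carrier G \<Longrightarrow> \<psi> g = \<psi>' g"
  shows "char_inner G \<chi> \<psi> = char_inner G \<chi>' \<psi>'"
  using assms by (simp add: char_inner_def cong: sum.cong)

lemma afforded_character_class_function:
  fixes G (structure)
  assumes "group G" "representation G n \<rho>" "g \<in> carrier G" "x \<in> carrier G"
  shows "afforded_character G \<rho> (g \<otimes> x \<otimes> inv g) = afforded_character G \<rho> x"
proof -
  interpret group G by fact
  show ?thesis
    using assms mat_trace_class_function[OF assms] by (simp add: afforded_character_def)
qed

lemma irreducible_character_class_function:
  fixes G (structure)
  assumes "group G" "\<chi> \<in> irreducible_characters G" "g \<in> carrier G" "x \<in> carrier G"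
  shows "\<chi> (g \<otimes> x \<otimes> inv g) = \<chi> x"
  using assms afforded_character_class_function[OF assms(1)] irreducible_representationD(1)
  unfolding irreducible_characters_def by blast

text \<open>In the order on \<open>complex\<close> this also says that the inner product is real,
  which multiplying inequalities requires.\<close>

lemma char_inner_monomial_nonneg:
  assumes G: "group G" and fin: "finite (carrier G)"
    and \<chi>: "\<chi> \<in> irreducible_characters G" and \<sigma>: "\<sigma> \<in> monomial_characters G"
  shows "char_inner G \<chi> \<sigma> \<ge> 0"
proof -
  interpret group G by (rule G)
  obtain n \<rho> where irr: "irreducible_representation G n \<rho>" and \<chi>\<rho>: "\<chi> = afforded_character G \<rho>"
    using \<chi> by (auto simp: irreducible_characters_def)
  obtain H \<phi> where H: "subgroup H G" and \<phi>: "\<phi> \<in> linear_characters (G\<lparr>carrier := H\<rparr>)"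
    and \<sigma>\<phi>: "\<sigma> = induced_character G H \<phi>"
    using \<sigma> by (auto simp: monomial_characters_def)
  have HG: "H \<subseteq> carrier G" using subgroup.subset[OF H] .
  have K: "group (G\<lparr>carrier := H\<rparr>)" using subgroup.subgroup_is_group[OF H G] .
  have finK: "finite (carrier (G\<lparr>carrier := H\<rparr>))" using HG fin finite_subset by auto
  have "representation (G\<lparr>carrier := H\<rparr>) n \<rho>"
    using irreducible_representationD(1)[OF irr] HG
    by (auto simp: group.representation_iff[OF K] representation_iff)
  from char_inner_linear_character_nat[OF K finK this \<phi>] obtain u :: nat
    where "char_inner (G\<lparr>carrier := H\<rparr>) (\<lambda>g. mat_trace (\<rho> g)) \<phi> = of_nat u" by blast
  moreover have "char_inner (G\<lparr>carrier := H\<rparr>) (\<lambda>g. mat_trace (\<rho> g)) \<phi> =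
      char_inner (G\<lparr>carrier := H\<rparr>) \<chi> \<phi>"
    using HG by (intro char_inner_cong) (auto simp: \<chi>\<rho> afforded_character_def)
  moreover have "char_inner G \<chi> \<sigma> = char_inner (G\<lparr>carrier := H\<rparr>) \<chi> \<phi>"
    unfolding \<sigma>\<phi> using irreducible_character_class_function[OF G \<chi>]
    by (intro char_inner_induced_character[OF G fin H])
  ultimately show ?thesis by (simp add: less_eq_complex_def)
qed

text \<open>Inducing the trivial character of the trivial subgroup gives the regular character; by
  Frobenius reciprocity its inner product with \<chi> is the degree of \<chi>.\<close>

lemma regular_character_monomial:
  fixes G (structure)
  assumes G: "group G" and fin: "finite (carrier G)"
  obtains \<sigma> where "\<sigma> \<in> monomial_characters G"
    "\<And>\<chi>. \<chi> \<in> irreducible_characters G \<Longrightarrow> char_inner G \<chi> \<sigma> > 0"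
proof -
  interpret group G by (rule G)
  let ?\<phi> = "\<lambda>g\<in>{\<one>}. 1 :: complex" and ?\<sigma> = "induced_character G {\<one>} (\<lambda>g\<in>{\<one>}. 1)"
  note triv = triv_subgroup
  have K: "group (G\<lparr>carrier := {\<one>}\<rparr>)" using subgroup.subgroup_is_group[OF triv G] .
  have "?\<phi> \<in> linear_characters (G\<lparr>carrier := {\<one>}\<rparr>)" by (simp add: linear_characters_iff[OF K])
  then have "?\<sigma> \<in> monomial_characters G" using triv by (auto simp: monomial_characters_def)
  moreover have "char_inner G \<chi> ?\<sigma> > 0" if \<chi>: "\<chi> \<in> irreducible_characters G" for \<chi>
  proof -
    obtain n \<rho> where irr: "irreducible_representation G n \<rho>" and \<chi>\<rho>: "\<chi> = afforded_character G \<rho>"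
      using \<chi> by (auto simp: irreducible_characters_def)
    have "char_inner G \<chi> ?\<sigma> = char_inner (G\<lparr>carrier := {\<one>}\<rparr>) \<chi> ?\<phi>"
      using irreducible_character_class_function[OF G \<chi>]
      by (intro char_inner_induced_character[OF G fin triv])
    also have "\<dots> = of_nat n"
      using representation_one[OF G irreducible_representationD(1)[OF irr]]
      by (simp add: char_inner_def Coset.order_def \<chi>\<rho> afforded_character_def)
    finally show ?thesis using irreducible_representationD(2)[OF irr] by (simp add: less_complex_def)
  qed
  ultimately show thesis using that by blast
qed

section \<open>Products and quotients\<close>

lemma char_inner_DirProd:
  assumes "\<And>g h. g \<in> carrier G \<Longrightarrow> h \<in> carrier H \<Longrightarrow> X (g, h) = \<chi> g * \<chi>' h"
    and "\<And>g h. g \<in> carrier G \<Longrightarrow> h \<in> carrier H \<Longrightarrow> Y (g, h) = \<psi> g * \<psi>' h"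
  shows "char_inner (G \<times>\<times> H) X Y = char_inner G \<chi> \<psi> * char_inner H \<chi>' \<psi>'"
proof -
  have "(\<Sum>k\<in>carrier G \<times> carrier H. X k * cnj (Y k)) =
      (\<Sum>(g, h)\<in>carrier G \<times> carrier H. (\<chi> g * cnj (\<psi> g)) * (\<chi>' h * cnj (\<psi>' h)))"
    using assms by (intro sum.cong) auto
  also have "\<dots> = (\<Sum>g\<in>carrier G. \<chi> g * cnj (\<psi> g)) * (\<Sum>h\<in>carrier H. \<chi>' h * cnj (\<psi>' h))"
    by (simp add: sum_product sum.cartesian_product)
  finally show ?thesis by (simp add: char_inner_def Coset.order_def card_cartesian_product)
qed

text \<open>\<open>\<tau>\<close> is induced from \<open>A \<times> B\<close> and the product of the
  two linear characters. Frobenius reciprocity on the product and on both factors reduces the claim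
  to sums over \<open>A\<close>, \<open>B\<close> and \<open>A \<times> B\<close>.\<close>

lemma monomial_character_DirProd:
  assumes G: "group G" "finite (carrier G)" and H: "group H" "finite (carrier H)"
    and \<sigma>: "\<sigma> \<in> monomial_characters G" and \<sigma>': "\<sigma>' \<in> monomial_characters H"
  obtains \<tau> where "\<tau> \<in> monomial_characters (G \<times>\<times> H)"
    "\<And>X \<chi> \<chi>'. X \<in> irreducible_characters (G \<times>\<times> H) \<Longrightarrow>
      \<chi> \<in> irreducible_characters G \<Longrightarrow> \<chi>' \<in> irreducible_characters H \<Longrightarrow>
      (\<And>g h. g \<in> carrier G \<Longrightarrow> h \<in> carrier H \<Longrightarrow> X (g, h) = \<chi> g * \<chi>' h) \<Longrightarrow>
      char_inner (G \<times>\<times> H) X \<tau> = char_inner G \<chi> \<sigma> * char_inner H \<chi>' \<sigma>'"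
proof -
  obtain A \<phi> where A: "subgroup A G" and \<phi>: "\<phi> \<in> linear_characters (G\<lparr>carrier := A\<rparr>)"
    and \<sigma>\<phi>: "\<sigma> = induced_character G A \<phi>"
    using \<sigma> by (auto simp: monomial_characters_def)
  obtain B \<psi> where B: "subgroup B H" and \<psi>: "\<psi> \<in> linear_characters (H\<lparr>carrier := B\<rparr>)"
    and \<sigma>'\<psi>: "\<sigma>' = induced_character H B \<psi>"
    using \<sigma>' by (auto simp: monomial_characters_def)
  let ?K = "G \<times>\<times> H"
  have K: "group ?K" using DirProd_group G(1) H(1) .
  have finK: "finite (carrier ?K)" using G H by simp
  have AB: "subgroup (A \<times> B) ?K" using DirProd_subgroups[OF G(1) A H(1) B] .
  have eq: "?K\<lparr>carrier := A \<times> B\<rparr> = G\<lparr>carrier := A\<rparr> \<times>\<times> H\<lparr>carrier := B\<rparr>"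
    by (simp add: DirProd_def)
  note gA = subgroup.subgroup_is_group[OF A G(1)]
  note gB = subgroup.subgroup_is_group[OF B H(1)]
  define \<mu> where "\<mu> = (\<lambda>(g, h)\<in>A \<times> B. \<phi> g * \<psi> h)"
  have "\<mu> \<in> linear_characters (?K\<lparr>carrier := A \<times> B\<rparr>)"
    using \<phi> \<psi> subgroup.m_closed[OF A] subgroup.m_closed[OF B]
      subgroup.one_closed[OF A] subgroup.one_closed[OF B]
    unfolding linear_characters_iff[OF subgroup.subgroup_is_group[OF AB K]]
      linear_characters_iff[OF gA] linear_characters_iff[OF gB]
    by (auto simp: \<mu>_def)
  then have "induced_character ?K (A \<times> B) \<mu> \<in> monomial_characters ?K"
    using AB by (auto simp: monomial_characters_def)
  moreover have "char_inner ?K X (induced_character ?K (A \<times> B) \<mu>) =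
      char_inner G \<chi> \<sigma> * char_inner H \<chi>' \<sigma>'"
    if X: "X \<in> irreducible_characters ?K" and \<chi>: "\<chi> \<in> irreducible_characters G"
      and \<chi>': "\<chi>' \<in> irreducible_characters H"
      and prod: "\<And>g h. g \<in> carrier G \<Longrightarrow> h \<in> carrier H \<Longrightarrow> X (g, h) = \<chi> g * \<chi>' h" for X \<chi> \<chi>'
  proof -
    have "char_inner ?K X (induced_character ?K (A \<times> B) \<mu>) =
        char_inner (?K\<lparr>carrier := A \<times> B\<rparr>) X \<mu>"
      using irreducible_character_class_function[OF K X]
      by (rule char_inner_induced_character[OF K finK AB])
    also have "\<dots> = char_inner (G\<lparr>carrier := A\<rparr>) \<chi> \<phi> * char_inner (H\<lparr>carrier := B\<rparr>) \<chi>' \<psi>"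
      unfolding eq using prod subgroup.subset[OF A] subgroup.subset[OF B]
      by (intro char_inner_DirProd) (auto simp: \<mu>_def)
    also have "char_inner (G\<lparr>carrier := A\<rparr>) \<chi> \<phi> = char_inner G \<chi> \<sigma>"
      unfolding \<sigma>\<phi> using irreducible_character_class_function[OF G(1) \<chi>]
      by (rule char_inner_induced_character[OF G A, symmetric])
    also have "char_inner (H\<lparr>carrier := B\<rparr>) \<chi>' \<psi> = char_inner H \<chi>' \<sigma>'"
      unfolding \<sigma>'\<psi> using irreducible_character_class_function[OF H(1) \<chi>']
      by (rule char_inner_induced_character[OF H B, symmetric])
    finally show ?thesis .
  qed
  ultimately show thesis using that by blast
qed

text \<open>An equality of functions, so that the two factors determine \<open>X\<close>: distinct
  characters of the product then differ in at least one factor.\<close>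

lemma irreducible_character_DirProd:
  assumes G: "group G" "finite (carrier G)" and H: "group H" "finite (carrier H)"
    and X: "X \<in> irreducible_characters (G \<times>\<times> H)"
  obtains \<chi> \<chi>' where "\<chi> \<in> irreducible_characters G" "\<chi>' \<in> irreducible_characters H"
    "X = (\<lambda>(g, h)\<in>carrier G \<times> carrier H. \<chi> g * \<chi>' h)"
proof -
  obtain n \<rho> where irr: "irreducible_representation (G \<times>\<times> H) n \<rho>"
    and X\<rho>: "X = afforded_character (G \<times>\<times> H) \<rho>"
    using X by (auto simp: irreducible_characters_def)
  obtain m \<omega> m' \<omega>' where \<omega>: "irreducible_representation G m \<omega>"
    and \<omega>': "irreducible_representation H m' \<omega>'"
    and tr: "\<And>g h. g \<in> carrier G \<Longrightarrow> h \<in> carrier H \<Longrightarrow>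
      mat_trace (\<rho> (g, h)) = mat_trace (\<omega> g) * mat_trace (\<omega>' h)"
    using irreducible_representation_DirProd[OF G H irr] by metis
  have "X = (\<lambda>(g, h)\<in>carrier G \<times> carrier H. afforded_character G \<omega> g * afforded_character H \<omega>' h)"
    by (auto simp: X\<rho> afforded_character_def tr restrict_def)
  then show thesis using that \<omega> \<omega>' by (auto simp: irreducible_characters_def)
qed

text \<open>All four numbers are real, being comparable with 0. One factor is changed at a time; the
  strict change is multiplied by \<open>a\<close> or \<open>b\<close>, hence their
  positivity.\<close>

lemma complex_mult_strict_mono:
  fixes a b c d :: complex
  assumes "0 \<le> c" "0 \<le> d" "c \<le> a" "d \<le> b" "0 < a" "0 < b" "c < a \<or> d < b"
  shows "c * d < a * b"
proof -
  have "Re c * Re d < Re a * Re b"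
    using assms(7)
  proof
    assume "c < a"
    then have "Re c * Re b < Re a * Re b" using assms by (simp add: less_complex_def)
    moreover have "Re c * Re d \<le> Re c * Re b"
      using assms by (intro mult_left_mono) (auto simp: less_eq_complex_def)
    ultimately show ?thesis by simp
  next
    assume "d < b"
    then have "Re a * Re d < Re a * Re b" using assms by (simp add: less_complex_def)
    moreover have "Re c * Re d \<le> Re a * Re d"
      using assms by (intro mult_right_mono) (auto simp: less_eq_complex_def)
    ultimately show ?thesis by simp
  qed
  then show ?thesis using assms by (auto simp: less_complex_def less_eq_complex_def)
qed

lemma weak_almost_monomial_DirProd:
  assumes G: "group G" "finite (carrier G)" and H: "group H" "finite (carrier H)"
    and wG: "weak_almost_monomial G" and wH: "weak_almost_monomial H"
  shows "weak_almost_monomial (G \<times>\<times> H)"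
  unfolding weak_almost_monomial_def
proof (intro ballI impI)
  fix X Y assume X: "X \<in> irreducible_characters (G \<times>\<times> H)" and Y: "Y \<in> irreducible_characters (G \<times>\<times> H)"
    and ne: "X \<noteq> Y"
  obtain \<chi> \<chi>' where \<chi>: "\<chi> \<in> irreducible_characters G" "\<chi>' \<in> irreducible_characters H"
    and X_eq: "X = (\<lambda>(g, h)\<in>carrier G \<times> carrier H. \<chi> g * \<chi>' h)"
    using irreducible_character_DirProd[OF G H X] by metis
  obtain \<psi> \<psi>' where \<psi>: "\<psi> \<in> irreducible_characters G" "\<psi>' \<in> irreducible_characters H"
    and Y_eq: "Y = (\<lambda>(g, h)\<in>carrier G \<times> carrier H. \<psi> g * \<psi>' h)"
    using irreducible_character_DirProd[OF G H Y] by metis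
  \<comment> \<open>One interface for both cases: positivity always, strict separation when the
    factors differ. When they agree, the two inner products with \<open>\<sigma>\<close> are equal,
    which the product inequality allows on one side.\<close>
  obtain \<sigma> where \<sigma>: "\<sigma> \<in> monomial_characters G" "char_inner G \<chi> \<sigma> > 0"
    "\<chi> \<noteq> \<psi> \<Longrightarrow> char_inner G \<chi> \<sigma> > char_inner G \<psi> \<sigma>"
  proof (cases "\<chi> = \<psi>")
    case True
    then show thesis using that regular_character_monomial[OF G] \<chi>(1) by metis
  next
    case False
    then obtain \<sigma> where "\<sigma> \<in> monomial_characters G" "char_inner G \<chi> \<sigma> > char_inner G \<psi> \<sigma>"
      using wG \<chi>(1) \<psi>(1) unfolding weak_almost_monomial_def by blast
    then show thesis using that char_inner_monomial_nonneg[OF G \<psi>(1)] by (meson le_less_trans)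
  qed
  obtain \<sigma>' where \<sigma>': "\<sigma>' \<in> monomial_characters H" "char_inner H \<chi>' \<sigma>' > 0"
    "\<chi>' \<noteq> \<psi>' \<Longrightarrow> char_inner H \<chi>' \<sigma>' > char_inner H \<psi>' \<sigma>'"
  proof (cases "\<chi>' = \<psi>'")
    case True
    then show thesis using that regular_character_monomial[OF H] \<chi>(2) by metis
  next
    case False
    then obtain \<sigma>' where "\<sigma>' \<in> monomial_characters H" "char_inner H \<chi>' \<sigma>' > char_inner H \<psi>' \<sigma>'"
      using wH \<chi>(2) \<psi>(2) unfolding weak_almost_monomial_def by blast
    then show thesis using that char_inner_monomial_nonneg[OF H \<psi>(2)] by (meson le_less_trans)
  qed
  obtain \<tau> where \<tau>: "\<tau> \<in> monomial_characters (G \<times>\<times> H)"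
    and inner: "\<And>X \<chi> \<chi>'. X \<in> irreducible_characters (G \<times>\<times> H) \<Longrightarrow>
      \<chi> \<in> irreducible_characters G \<Longrightarrow> \<chi>' \<in> irreducible_characters H \<Longrightarrow>
      (\<And>g h. g \<in> carrier G \<Longrightarrow> h \<in> carrier H \<Longrightarrow> X (g, h) = \<chi> g * \<chi>' h) \<Longrightarrow>
      char_inner (G \<times>\<times> H) X \<tau> = char_inner G \<chi> \<sigma> * char_inner H \<chi>' \<sigma>'"
    using monomial_character_DirProd[OF G H \<sigma>(1) \<sigma>'(1)] by metis
  have "char_inner (G \<times>\<times> H) X \<tau> = char_inner G \<chi> \<sigma> * char_inner H \<chi>' \<sigma>'"
    "char_inner (G \<times>\<times> H) Y \<tau> = char_inner G \<psi> \<sigma> * char_inner H \<psi>' \<sigma>'"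
    using X Y \<chi> \<psi> by (auto intro!: inner simp: X_eq Y_eq)
  moreover have nonneg: "char_inner G \<psi> \<sigma> \<ge> 0" "char_inner H \<psi>' \<sigma>' \<ge> 0"
    using char_inner_monomial_nonneg[OF G \<psi>(1) \<sigma>(1)] char_inner_monomial_nonneg[OF H \<psi>(2) \<sigma>'(1)] .
  have "char_inner G \<psi> \<sigma> * char_inner H \<psi>' \<sigma>' < char_inner G \<chi> \<sigma> * char_inner H \<chi>' \<sigma>'"
  proof (rule complex_mult_strict_mono[OF nonneg _ _ \<sigma>(2) \<sigma>'(2)])
    show "char_inner G \<psi> \<sigma> \<le> char_inner G \<chi> \<sigma>"
      using \<sigma>(3) by (cases "\<chi> = \<psi>") (auto intro: less_imp_le)
    show "char_inner H \<psi>' \<sigma>' \<le> char_inner H \<chi>' \<sigma>'"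
      using \<sigma>'(3) by (cases "\<chi>' = \<psi>'") (auto intro: less_imp_le)
    have "\<chi> \<noteq> \<psi> \<or> \<chi>' \<noteq> \<psi>'" using ne X_eq Y_eq by auto
    then show "char_inner G \<psi> \<sigma> < char_inner G \<chi> \<sigma> \<or> char_inner H \<psi>' \<sigma>' < char_inner H \<chi>' \<sigma>'"
      using \<sigma>(3) \<sigma>'(3) by blast
  qed
  ultimately have "char_inner (G \<times>\<times> H) X \<tau> > char_inner (G \<times>\<times> H) Y \<tau>" by simp
  then show "\<exists>\<tau>\<in>monomial_characters (G \<times>\<times> H).
      char_inner (G \<times>\<times> H) X \<tau> > char_inner (G \<times>\<times> H) Y \<tau>"
    using \<tau> by blast
qed

section \<open>Inflation along a surjective homomorphism and passage to quotients\<close>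

lemma char_inner_pullback:
  fixes K (structure)
  assumes K: "group K" and fin: "finite (carrier K)" and G: "group G"
    and p: "p \<in> hom K G" and surj: "p ` carrier K = carrier G"
    and \<chi>: "\<And>k. k \<in> carrier K \<Longrightarrow> \<chi>' k = \<chi> (p k)"
    and \<psi>: "\<And>k. k \<in> carrier K \<Longrightarrow> \<psi>' k = \<psi> (p k)"
  shows "char_inner K \<chi>' \<psi>' = char_inner G \<chi> \<psi>"
proof -
  interpret K: group K by (rule K)
  interpret G: group G by (rule G)
  let ?f = "\<lambda>y. \<chi> y * cnj (\<psi> y)"
  have finG: "finite (carrier G)" using surj fin by (metis finite_imageI)
  have shift: "(\<Sum>k\<in>carrier K. ?f (p k \<otimes>\<^bsub>G\<^esub> y)) = (\<Sum>k\<in>carrier K. ?f (p k))"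
    if y: "y \<in> carrier G" for y
  proof -
    obtain a where a: "a \<in> carrier K" "y = p a" using y surj by blast
    have "(\<Sum>k\<in>carrier K. ?f (p k \<otimes>\<^bsub>G\<^esub> y)) = (\<Sum>k\<in>carrier K. ?f (p (k \<otimes> a)))"
      using a hom_mult[OF p] by (intro sum.cong) auto
    also have "\<dots> = (\<Sum>k\<in>carrier K. ?f (p k))"
      by (rule sum.reindex_bij_betw[OF K.bij_betw_mult_right[OF a(1)], of "\<lambda>k. ?f (p k)"])
    finally show ?thesis .
  qed
  have "of_nat (Coset.order G) * (\<Sum>k\<in>carrier K. ?f (p k)) =
      (\<Sum>y\<in>carrier G. \<Sum>k\<in>carrier K. ?f (p k \<otimes>\<^bsub>G\<^esub> y))"
    using shift by (simp add: Coset.order_def)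
  also have "\<dots> = (\<Sum>k\<in>carrier K. \<Sum>y\<in>carrier G. ?f (p k \<otimes>\<^bsub>G\<^esub> y))"
    by (rule sum.swap)
  also have "\<dots> = (\<Sum>k\<in>carrier K. \<Sum>y\<in>carrier G. ?f y)"
    by (intro sum.cong refl sum.reindex_bij_betw[OF G.bij_betw_mult_left, of _ ?f])
      (rule hom_in_carrier[OF p])
  finally have "of_nat (Coset.order G) * (\<Sum>k\<in>carrier K. ?f (p k)) =
      of_nat (Coset.order K) * (\<Sum>y\<in>carrier G. ?f y)"
    by (simp add: Coset.order_def)
  moreover have "Coset.order G \<noteq> 0" "Coset.order K \<noteq> 0"
    using finG fin G.one_closed K.one_closed by (auto simp: Coset.order_def)
  moreover have "(\<Sum>k\<in>carrier K. \<chi>' k * cnj (\<psi>' k)) = (\<Sum>k\<in>carrier K. ?f (p k))"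
    using \<chi> \<psi> by (intro sum.cong) auto
  ultimately show ?thesis by (simp add: char_inner_def field_simps)
qed

text \<open>By surjectivity the same matrices act, so the invariant subspaces are the same.\<close>

lemma irreducible_representation_pullback:
  assumes K: "group K" and G: "group G" and p: "p \<in> hom K G" and surj: "p ` carrier K = carrier G"
    and irr: "irreducible_representation G n \<rho>"
  shows "irreducible_representation K n (\<lambda>k. \<rho> (p k))"
proof -
  have "representation G n \<rho>" using irreducible_representationD(1)[OF irr] .
  then have "representation K n (\<lambda>k. \<rho> (p k))"
    using hom_one[OF p K G] hom_mult[OF p] hom_in_carrier[OF p]
    by (simp add: group.representation_iff[OF K] group.representation_iff[OF G])
  moreover have "invariant_subspace G n \<rho> W" if "invariant_subspace K n (\<lambda>k. \<rho> (p k)) W" for W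
    using that unfolding invariant_subspace_def surj[symmetric] by auto
  ultimately show ?thesis using irr by (auto simp: irreducible_representation_def)
qed

text \<open>Translating the sum by \<open>a\<close> multiplies it by \<open>cnj (\<phi> a)\<close>,
  which differs from 1.\<close>

lemma char_inner_eq_0:
  fixes K (structure)
  assumes K: "group K" and \<phi>: "\<phi> \<in> linear_characters K"
    and a: "a \<in> carrier K" "\<phi> a \<noteq> 1" and inv: "\<And>k. k \<in> carrier K \<Longrightarrow> \<chi> (k \<otimes> a) = \<chi> k"
  shows "char_inner K \<chi> \<phi> = 0"
proof -
  interpret group K by (rule K)
  let ?S = "\<Sum>k\<in>carrier K. \<chi> k * cnj (\<phi> k)"
  have "?S = (\<Sum>k\<in>carrier K. \<chi> (k \<otimes> a) * cnj (\<phi> (k \<otimes> a)))"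
    by (rule sum.reindex_bij_betw[OF bij_betw_mult_right[OF a(1)], symmetric])
  also have "\<dots> = cnj (\<phi> a) * ?S"
    using \<phi> a(1) inv by (simp add: linear_characters_iff[OF K] sum_distrib_left mult_ac)
  finally have "(1 - cnj (\<phi> a)) * ?S = 0" by (simp add: algebra_simps)
  moreover have "1 - cnj (\<phi> a) \<noteq> 0"
    using a(2) by (metis complex_cnj_cancel_iff complex_cnj_one right_minus_eq)
  ultimately show ?thesis by (simp add: char_inner_def)
qed

text \<open>Two elements with the same image differ by an element of the kernel, where \<phi> is 1.
  So \<phi> is constant on fibres, and \<open>\<psi>\<close> may be read off at any chosen
  preimage.\<close>

lemma linear_character_descends:
  assumes K: "group K" and G: "group G" and p: "p \<in> hom K G" and surj: "p ` carrier K = carrier G"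
    and \<phi>: "\<phi> \<in> linear_characters K"
    and triv: "\<And>a. a \<in> carrier K \<Longrightarrow> p a = \<one>\<^bsub>G\<^esub> \<Longrightarrow> \<phi> a = 1"
  obtains \<psi> where "\<psi> \<in> linear_characters G" "\<And>k. k \<in> carrier K \<Longrightarrow> \<phi> k = \<psi> (p k)"
proof -
  interpret K: group K by (rule K)
  interpret G: group G by (rule G)
  interpret p: group_hom K G p using p by unfold_locales
  have \<phi>': "\<phi> \<one>\<^bsub>K\<^esub> = 1" "\<And>a b. a \<in> carrier K \<Longrightarrow> b \<in> carrier K \<Longrightarrow> \<phi> (a \<otimes>\<^bsub>K\<^esub> b) = \<phi> a * \<phi> b"
    using \<phi> by (auto simp: linear_characters_iff[OF K])
  have fibre: "\<phi> a = \<phi> b" if ab: "a \<in> carrier K" "b \<in> carrier K" "p a = p b" for a b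
  proof -
    have "p (a \<otimes>\<^bsub>K\<^esub> inv\<^bsub>K\<^esub> b) = \<one>\<^bsub>G\<^esub>" using ab by simp
    then have "\<phi> (a \<otimes>\<^bsub>K\<^esub> inv\<^bsub>K\<^esub> b) = 1" using triv ab by simp
    then have "\<phi> (a \<otimes>\<^bsub>K\<^esub> inv\<^bsub>K\<^esub> b \<otimes>\<^bsub>K\<^esub> b) = \<phi> b" using ab by (subst \<phi>'(2)) auto
    then show ?thesis using ab by (simp add: K.m_assoc)
  qed
  define \<psi> where "\<psi> = (\<lambda>y\<in>carrier G. \<phi> (inv_into (carrier K) p y))"
  have \<psi>: "\<phi> k = \<psi> (p k)" if "k \<in> carrier K" for k
    using that fibre[OF that inv_into_into[of "p k" p]] f_inv_into_f[of "p k" p "carrier K"]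
    by (simp add: \<psi>_def)
  have "\<psi> (x \<otimes>\<^bsub>G\<^esub> y) = \<psi> x * \<psi> y" if xy: "x \<in> carrier G" "y \<in> carrier G" for x y
  proof -
    obtain a b where "a \<in> carrier K" "x = p a" "b \<in> carrier K" "y = p b" using xy surj by blast
    then show ?thesis using \<phi>'(2) \<psi> by (metis K.m_closed p.hom_mult)
  qed
  moreover have "\<psi> \<one>\<^bsub>G\<^esub> = 1" using \<psi>[OF K.one_closed] \<phi>'(1) by simp
  moreover have "\<psi> \<in> extensional (carrier G)" by (simp add: \<psi>_def)
  ultimately have "\<psi> \<in> linear_characters G" by (simp add: linear_characters_iff[OF G])
  then show thesis using that \<psi> by blast
qed

text \<open>A linear character \<open>\<phi>\<close> of \<open>H\<close> is either nontrivial on \<open>H \<inter> ker p\<close>, and then \<open>\<phi>\<^sup>K\<close> has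
  no constituent inflated from \<open>G\<close>, or it is inflated from \<open>p H\<close>.\<close>

lemma weak_almost_monomial_quotient:
  fixes K (structure)
  assumes K: "group K" and fin: "finite (carrier K)" and G: "group G"
    and p: "p \<in> hom K G" and surj: "p ` carrier K = carrier G" and w: "weak_almost_monomial K"
  shows "weak_almost_monomial G"
  unfolding weak_almost_monomial_def
proof (intro ballI impI)
  interpret K: group K by (rule K)
  interpret G: group G by (rule G)
  interpret p: group_hom K G p using p by unfold_locales
  have finG: "finite (carrier G)" using surj fin by (metis finite_imageI)
  define infl where "infl \<chi> = (\<lambda>k\<in>carrier K. \<chi> (p k))" for \<chi> :: "_ \<Rightarrow> complex"
  have infl: "infl \<chi> \<in> irreducible_characters K" if \<chi>: "\<chi> \<in> irreducible_characters G" for \<chi>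
  proof -
    obtain n \<rho> where \<rho>: "irreducible_representation G n \<rho>" "\<chi> = afforded_character G \<rho>"
      using \<chi> by (auto simp: irreducible_characters_def)
    have "infl \<chi> = afforded_character K (\<lambda>k. \<rho> (p k))"
      unfolding infl_def \<rho>(2) afforded_character_def using p.hom_closed
      by (intro restrict_ext) simp
    then show ?thesis
      using irreducible_representation_pullback[OF K G p surj \<rho>(1)]
      by (auto simp: irreducible_characters_def)
  qed
  fix \<chi> \<psi> assume \<chi>: "\<chi> \<in> irreducible_characters G" and \<psi>: "\<psi> \<in> irreducible_characters G"
    and ne: "\<chi> \<noteq> \<psi>"
  have "infl \<chi> \<noteq> infl \<psi>"
  proof
    assume eq: "infl \<chi> = infl \<psi>"
    have "\<chi> = \<psi>"
    proof (rule extensionalityI[of _ "carrier G"])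
      show "\<chi> \<in> extensional (carrier G)" "\<psi> \<in> extensional (carrier G)"
        using \<chi> \<psi> by (auto simp: irreducible_characters_def afforded_character_def)
      fix y assume "y \<in> carrier G"
      then obtain k where "k \<in> carrier K" "y = p k" using surj by blast
      then show "\<chi> y = \<psi> y" using fun_cong[OF eq, of k] by (simp add: infl_def)
    qed
    then show False using ne by simp
  qed
  then obtain \<sigma> where \<sigma>: "\<sigma> \<in> monomial_characters K"
    and less: "char_inner K (infl \<psi>) \<sigma> < char_inner K (infl \<chi>) \<sigma>"
    using w infl[OF \<chi>] infl[OF \<psi>] unfolding weak_almost_monomial_def by blast
  obtain H \<phi> where H: "subgroup H K" and \<phi>: "\<phi> \<in> linear_characters (K\<lparr>carrier := H\<rparr>)"
    and \<sigma>\<phi>: "\<sigma> = induced_character K H \<phi>"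
    using \<sigma> by (auto simp: monomial_characters_def)
  let ?KH = "K\<lparr>carrier := H\<rparr>" and ?GH = "G\<lparr>carrier := p ` H\<rparr>"
  have HK: "H \<subseteq> carrier K" using subgroup.subset[OF H] .
  have KH: "group ?KH" using subgroup.subgroup_is_group[OF H K] .
  have pH: "subgroup (p ` H) G" using p.subgroup_img_is_subgroup[OF H] .
  have GH: "group ?GH" using subgroup.subgroup_is_group[OF pH G] .
  have finH: "finite (carrier ?KH)" using HK fin finite_subset by auto
  have pKH: "p \<in> hom ?KH ?GH" using HK by (auto simp: hom_def subset_iff)
  have surjH: "p ` carrier ?KH = carrier ?GH" by simp
  have frob: "char_inner K (infl \<theta>) \<sigma> = char_inner ?KH (infl \<theta>) \<phi>"
    if "\<theta> \<in> irreducible_characters G" for \<theta>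
    unfolding \<sigma>\<phi> using irreducible_character_class_function[OF K infl[OF that]]
    by (rule char_inner_induced_character[OF K fin H])
  \<comment> \<open>Inflated characters are unchanged by translation with the kernel element
    \<open>a\<close>. If \<phi> were nontrivial there, both inner products with
    \<open>\<sigma>\<close> would be 0, against the strict inequality.\<close>
  have "\<phi> a = 1" if a: "a \<in> carrier ?KH" "p a = \<one>\<^bsub>?GH\<^esub>" for a
  proof (rule ccontr)
    assume ne: "\<phi> a \<noteq> 1"
    have "char_inner ?KH (infl \<theta>) \<phi> = 0" for \<theta>
    proof (rule char_inner_eq_0[OF KH \<phi> a(1) ne])
      fix k assume "k \<in> carrier ?KH"
      then have "k \<in> carrier K" "a \<in> carrier K" using a HK by auto
      then show "infl \<theta> (k \<otimes>\<^bsub>?KH\<^esub> a) = infl \<theta> k" using a(2) by (simp add: infl_def)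
    qed
    then show False using less frob[OF \<chi>] frob[OF \<psi>] by simp
  qed
  then obtain \<mu> where \<mu>: "\<mu> \<in> linear_characters ?GH" "\<And>k. k \<in> carrier ?KH \<Longrightarrow> \<phi> k = \<mu> (p k)"
    using linear_character_descends[OF KH GH pKH surjH \<phi>] by metis
  have "char_inner K (infl \<theta>) \<sigma> = char_inner G \<theta> (induced_character G (p ` H) \<mu>)"
    if \<theta>: "\<theta> \<in> irreducible_characters G" for \<theta>
  proof -
    have "char_inner ?KH (infl \<theta>) \<phi> = char_inner ?GH \<theta> \<mu>"
      using \<mu>(2) HK by (intro char_inner_pullback[OF KH finH GH pKH surjH]) (auto simp: infl_def)
    also have "\<dots> = char_inner G \<theta> (induced_character G (p ` H) \<mu>)"
      using irreducible_character_class_function[OF G \<theta>]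
      by (rule char_inner_induced_character[OF G finG pH, symmetric])
    finally show ?thesis using frob[OF \<theta>] by simp
  qed
  moreover have "induced_character G (p ` H) \<mu> \<in> monomial_characters G"
    using pH \<mu>(1) by (auto simp: monomial_characters_def)
  ultimately show "\<exists>\<sigma>\<in>monomial_characters G. char_inner G \<chi> \<sigma> > char_inner G \<psi> \<sigma>"
    using less \<chi> \<psi> by auto
qed

theorem theorem2p10:
  fixes G :: "('a, 'c) monoid_scheme" and G' :: "('b, 'd) monoid_scheme"
  assumes "group G" and "finite (carrier G)"
    and "group G'" and "finite (carrier G')"
  shows "weak_almost_monomial G \<and> weak_almost_monomial G' \<longleftrightarrow> weak_almost_monomial (G \<times>\<times> G')"
proof
  assume "weak_almost_monomial G \<and> weak_almost_monomial G'"
  then show "weak_almost_monomial (G \<times>\<times> G')"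
    using weak_almost_monomial_DirProd[OF assms] by blast
next
  assume w: "weak_almost_monomial (G \<times>\<times> G')"
  have K: "group (G \<times>\<times> G')" "finite (carrier (G \<times>\<times> G'))"
    using DirProd_group assms by auto
  \<comment> \<open>Each projection is onto because the other factor has an element, its
    unit.\<close>
  have "\<one>\<^bsub>G\<^esub> \<in> carrier G" "\<one>\<^bsub>G'\<^esub> \<in> carrier G'"
    using assms(1,3) by (auto intro: monoid.one_closed group.is_monoid)
  then have "fst ` carrier (G \<times>\<times> G') = carrier G" "snd ` carrier (G \<times>\<times> G') = carrier G'"
    by force+
  moreover have "fst \<in> hom (G \<times>\<times> G') G" "snd \<in> hom (G \<times>\<times> G') G'"
    by (auto simp: hom_def)
  ultimately show "weak_almost_monomial G \<and> weak_almost_monomial G'"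
    using weak_almost_monomial_quotient[OF K assms(1) _ _ w]
      weak_almost_monomial_quotient[OF K assms(3) _ _ w] by blast
qed

end
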